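(* Let $2\le d\le4$, let $\mathcal O\subset\mathbb R^d$ be a domain as in the context, let $\mu>0$, $\beta\ge0$, $p\ge 2$ with $p>\frac d2$, and $r\ge2$. Set $\mathscr H(\boldsymbol x)=\mu\mathcal A(\boldsymbol x)+\mathrm B(\boldsymbol x)+\beta\mathcal C(\boldsymbol x)$. Let $C$ be the constant in the Gagliardo–Nirenberg inequality $\|\boldsymbol z\|_{\mathrm L^{\frac{2p}{p-1}}}^2\le C\|\boldsymbol z\|_{\mathbb V}^{\frac dp}\|\boldsymbol z\|_{\mathbb H}^{\frac{2p-d}{p}}$, $\boldsymbol z\in\mathbb V$, and put $$\widetilde\eta=C^{\frac{2p}{2p-d}}\Big(\frac{2p-d}{2p}\Big)\Big(\frac{d}{\mu p}\Big)^{\frac{d}{2p-d}}.$$ Then for every $N>0$, all $\boldsymbol x,\boldsymbol y\in\mathbb V_p\cap\widetilde{\mathbb L}^r$ with $\boldsymbol y\in\widehat{\mathbb B}_N:=\{\boldsymbol z\in\mathbb V_p:\|\boldsymbol z\|_{\mathbb V_p}\le N\}$, $$\langle\mathscr H(\boldsymbol x)-\mathscr H(\boldsymbol y),\boldsymbol x-\boldsymbol y\rangle+\widetilde\eta N^{\frac{2p}{2p-d}}\|\boldsymbol x-\boldsymbol y\|_{\mathbb H}^2\ge0.$$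
   Context: Domain. $\mathcal O\subset\mathbb R^d$ ($2\le d\le4$) is open and connected, possibly unbounded, with boundary uniformly of class $\mathrm C^2$, and for every $p\in[1,\infty)$ there is $\lambda_{1,p}>0$ with $\lambda_{1,p}\int_{\mathcal O}|\psi|^p\,\mathrm dx\le\int_{\mathcal O}|\nabla\psi|^p\,\mathrm dx$ for all $\psi\in \mathrm W_0^{1,p}(\mathcal O;\mathbb R^d)$. Spaces. $\mathscr V=\{\boldsymbol u\in \mathrm C_0^\infty(\mathcal O;\mathbb R^d):\nabla\cdot\boldsymbol u=0\}$. $\mathbb H$, $\mathbb V$, $\widetilde{\mathbb L}^r$, $\mathbb V_p$ are the closures of $\mathscr V$ in $\mathrm L^2(\mathcal O;\mathbb R^d)$, $\mathrm H_0^1(\mathcal O;\mathbb R^d)$, $\mathrm L^r(\mathcal O;\mathbb R^d)$, $\mathrm W_0^{1,p}(\mathcal O;\mathbb R^d)$, with norms $\|\boldsymbol u\|_{\mathbb H}=\|\boldsymbol u\|_{\mathrm L^2}$, $\|\boldsymbol u\|_{\mathbb V}=\|\nabla\boldsymbol u\|_{\mathrm L^2}$, $\|\boldsymbol u\|_{\widetilde{\mathbb L}^r}=\|\boldsymbol u\|_{\mathrm L^r}$, $\|\boldsymbol u\|_{\mathbb V_p}=\|\nabla\boldsymbol u\|_{\mathrm L^p}$. The continuous embeddings $\mathbb V_p\hookrightarrow\mathbb V$ and $\mathbb V_p\cap\widetilde{\mathbb L}^r\hookrightarrow\mathbb H\equiv\mathbb H'\hookrightarrow\mathbb V_p'+\widetilde{\mathbb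 L}^{r/(r-1)}$ are in force (with $\widetilde{\mathbb L}^{r/(r-1)}$ identified with the dual of $\widetilde{\mathbb L}^r$), and $\langle\cdot,\cdot\rangle$ is the pairing between $\mathbb V_p'+\widetilde{\mathbb L}^{r/(r-1)}$ and $\mathbb V_p\cap\widetilde{\mathbb L}^r$. Operators. $\langle\mathcal A(\boldsymbol x),\boldsymbol y\rangle=\int_{\mathcal O}(1+|\nabla\boldsymbol x|^2)^{\frac{p-2}2}\nabla\boldsymbol x:\nabla\boldsymbol y\,\mathrm dx$; $\langle\mathrm B(\boldsymbol x),\boldsymbol y\rangle=\int_{\mathcal O}(\boldsymbol x\cdot\nabla)\boldsymbol x\cdot\boldsymbol y\,\mathrm dx$; $\langle\mathcal C(\boldsymbol x),\boldsymbol y\rangle=\int_{\mathcal O}|\boldsymbol x|^{r-2}\boldsymbol x\cdot\boldsymbol y\,\mathrm dx$, for $\boldsymbol x,\boldsymbol y\in\mathbb V_p\cap\widetilde{\mathbb L}^r$. *)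

theory Defs
  imports "HOL-Analysis.Analysis"
begin

subsection \<open>Classical differentiability, test functions, and regular boundaries\<close>

text \<open>
  On open subsets of a Euclidean space, this says that all partial derivatives up to order
  \<open>k\<close> exist and are continuous.
\<close>

primrec Ck_on :: "nat \<Rightarrow> 'a::euclidean_space set \<Rightarrow> ('a \<Rightarrow> 'b::real_normed_vector) \<Rightarrow> bool" where
  "Ck_on 0 S f \<longleftrightarrow> continuous_on S f"
| "Ck_on (Suc k) S f \<longleftrightarrow>
     (\<forall>x\<in>S. f differentiable (at x)) \<and> (\<forall>v. Ck_on k S (\<lambda>x. frechet_derivative f (at x) v))"

definition test_functions :: "'a::euclidean_space set \<Rightarrow> ('a \<Rightarrow> 'b::real_normed_vector) set" where
  "test_functions \<Omega> =
     {\<phi>. (\<forall>k. Ck_on k UNIV \<phi>) \<and> compact (closure {x. \<phi> x \<noteq> 0}) \<and> closure {x. \<phi> x \<noteq> 0} \<subseteq> \<Omega>}"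

text \<open>
  Around each boundary point \<open>x0\<close> the domain is a subgraph, in a Cartesian coordinate system
  centred at \<open>x0\<close> whose last axis is the unit vector \<open>\<nu>\<close>, with the size \<open>a\<close>, \<open>b\<close> of the
  chart and the \<open>C\<^sup>2\<close> bound \<open>K\<close> independent of \<open>x0\<close>. The graph function \<open>h\<close> of the
  \<open>d - 1\<close> tangential coordinates is represented as a function on the whole space that is
  invariant in direction \<open>\<nu>\<close>.
\<close>

definition uniformly_C2_boundary :: "'a::euclidean_space set \<Rightarrow> bool" where
  "uniformly_C2_boundary \<Omega> \<longleftrightarrow>
     (\<exists>a>0. \<exists>b>0. \<exists>K>0. \<forall>x0\<in>frontier \<Omega>. \<exists>\<nu> h.
        let D = {y. norm (y - (y \<bullet> \<nu>) *\<^sub>R \<nu>) < a} in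
        norm \<nu> = 1 \<and>
        (\<forall>y. h y = h (y - (y \<bullet> \<nu>) *\<^sub>R \<nu>)) \<and>
        h 0 = (0::real) \<and>
        Ck_on 2 D h \<and>
        (\<forall>y\<in>D. \<bar>h y\<bar> \<le> K \<and>
           (\<forall>v. \<bar>frechet_derivative h (at y) v\<bar> \<le> K * norm v) \<and>
           (\<forall>v w. \<bar>frechet_derivative (\<lambda>z. frechet_derivative h (at z) v) (at y) w\<bar>
                    \<le> K * norm v * norm w)) \<and>
        (\<forall>y\<in>D. \<bar>y \<bullet> \<nu> - h y\<bar> < b \<longrightarrow>
           (x0 + y \<in> \<Omega> \<longleftrightarrow> y \<bullet> \<nu> < h y) \<and> (x0 + y \<in> frontier \<Omega> \<longleftrightarrow> y \<bullet> \<nu> = h y)))"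


subsection \<open>Lebesgue and Sobolev spaces\<close>

text \<open>
  Elements of the function spaces are represented by functions on the whole space. Only their
  values almost everywhere in \<open>\<Omega>\<close> matter. \<open>Lp_norm\<close> is meaningful on \<open>Lp_space\<close> only.
\<close>

definition Lp_space :: "'a::euclidean_space set \<Rightarrow> real \<Rightarrow> ('a \<Rightarrow> 'b::euclidean_space) set" where
  "Lp_space \<Omega> p = {u. u \<in> borel_measurable (lebesgue_on \<Omega>) \<and>
                       integrable (lebesgue_on \<Omega>) (\<lambda>s. norm (u s) powr p)}"

definition Lp_norm :: "'a::euclidean_space set \<Rightarrow> real \<Rightarrow> ('a \<Rightarrow> 'b::euclidean_space) \<Rightarrow> real" where
  "Lp_norm \<Omega> p u = (LINT s|lebesgue_on \<Omega>. norm (u s) powr p) powr (1 / p)"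

text \<open>
  The entry \<open>G s $ i $ j\<close> is the weak partial derivative of the \<open>i\<close>-th component of \<open>u\<close> in
  direction \<open>j\<close>. For open \<open>\<Omega>\<close>, such a \<open>G\<close> is unique almost
  everywhere in \<open>\<Omega>\<close>. Norm and inner product on \<open>real^'n^'n\<close> are the Frobenius ones.
\<close>

definition is_weak_gradient ::
    "(real^'n) set \<Rightarrow> (real^'n \<Rightarrow> real^'n) \<Rightarrow> (real^'n \<Rightarrow> real^'n^'n) \<Rightarrow> bool" where
  "is_weak_gradient \<Omega> u G \<longleftrightarrow>
     (\<forall>K. compact K \<and> K \<subseteq> \<Omega> \<longrightarrow> u absolutely_integrable_on K \<and> G absolutely_integrable_on K) \<and>
     (\<forall>\<phi>\<in>test_functions \<Omega>. \<forall>i j.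
        (LINT s|lebesgue_on \<Omega>. u s $ i * frechet_derivative \<phi> (at s) (axis j 1))
        = - (LINT s|lebesgue_on \<Omega>. G s $ i $ j * \<phi> s))"

definition weak_gradient ::
    "(real^'n) set \<Rightarrow> (real^'n \<Rightarrow> real^'n) \<Rightarrow> (real^'n \<Rightarrow> real^'n^'n)" where
  "weak_gradient \<Omega> u = (SOME G. is_weak_gradient \<Omega> u G)"

definition W1p_space :: "(real^'n) set \<Rightarrow> real \<Rightarrow> (real^'n \<Rightarrow> real^'n) set" where
  "W1p_space \<Omega> p = {u \<in> Lp_space \<Omega> p. \<exists>G\<in>Lp_space \<Omega> p. is_weak_gradient \<Omega> u G}"

definition W1p_norm :: "(real^'n) set \<Rightarrow> real \<Rightarrow> (real^'n \<Rightarrow> real^'n) \<Rightarrow> real" where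
  "W1p_norm \<Omega> p u =
     (Lp_norm \<Omega> p u powr p + Lp_norm \<Omega> p (weak_gradient \<Omega> u) powr p) powr (1 / p)"

definition norm_closure :: "(('a \<Rightarrow> 'b::minus) \<Rightarrow> real) \<Rightarrow> ('a \<Rightarrow> 'b) set \<Rightarrow> ('a \<Rightarrow> 'b) set \<Rightarrow> ('a \<Rightarrow> 'b) set"
  where
  "norm_closure N X S = {u \<in> X. \<forall>e>0. \<exists>\<phi>\<in>S. N (u - \<phi>) < e}"

definition W01p_space :: "(real^'n) set \<Rightarrow> real \<Rightarrow> (real^'n \<Rightarrow> real^'n) set" where
  "W01p_space \<Omega> p = norm_closure (W1p_norm \<Omega> p) (W1p_space \<Omega> p) (test_functions \<Omega>)"

definition poincare_domain :: "(real^'n) set \<Rightarrow> bool" where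
  "poincare_domain \<Omega> \<longleftrightarrow>
     (\<forall>p\<ge>1. \<exists>l>0. \<forall>\<psi>\<in>W01p_space \<Omega> p.
        l * (LINT s|lebesgue_on \<Omega>. norm (\<psi> s) powr p)
        \<le> (LINT s|lebesgue_on \<Omega>. norm (weak_gradient \<Omega> \<psi> s) powr p))"


subsection \<open>Solenoidal spaces\<close>

definition solenoidal_tests :: "(real^'n) set \<Rightarrow> (real^'n \<Rightarrow> real^'n) set" where
  "solenoidal_tests \<Omega> = {u \<in> test_functions \<Omega>. \<forall>x. trace (jacobian u (at x)) = 0}"

definition H_space :: "(real^'n) set \<Rightarrow> (real^'n \<Rightarrow> real^'n) set" where
  "H_space \<Omega> = norm_closure (Lp_norm \<Omega> 2) (Lp_space \<Omega> 2) (solenoidal_tests \<Omega>)"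

definition Ltilde_space :: "(real^'n) set \<Rightarrow> real \<Rightarrow> (real^'n \<Rightarrow> real^'n) set" where
  "Ltilde_space \<Omega> r = norm_closure (Lp_norm \<Omega> r) (Lp_space \<Omega> r) (solenoidal_tests \<Omega>)"

definition Vp_space :: "(real^'n) set \<Rightarrow> real \<Rightarrow> (real^'n \<Rightarrow> real^'n) set" where
  "Vp_space \<Omega> p = norm_closure (W1p_norm \<Omega> p) (W01p_space \<Omega> p) (solenoidal_tests \<Omega>)"

abbreviation V_space :: "(real^'n) set \<Rightarrow> (real^'n \<Rightarrow> real^'n) set" where
  "V_space \<Omega> \<equiv> Vp_space \<Omega> 2"

abbreviation H_norm :: "(real^'n) set \<Rightarrow> (real^'n \<Rightarrow> real^'n) \<Rightarrow> real" where
  "H_norm \<Omega> u \<equiv> Lp_norm \<Omega> 2 u"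

definition Vp_norm :: "(real^'n) set \<Rightarrow> real \<Rightarrow> (real^'n \<Rightarrow> real^'n) \<Rightarrow> real" where
  "Vp_norm \<Omega> p u = Lp_norm \<Omega> p (weak_gradient \<Omega> u)"

abbreviation V_norm :: "(real^'n) set \<Rightarrow> (real^'n \<Rightarrow> real^'n) \<Rightarrow> real" where
  "V_norm \<Omega> u \<equiv> Vp_norm \<Omega> 2 u"

definition Vp_ball :: "(real^'n) set \<Rightarrow> real \<Rightarrow> real \<Rightarrow> (real^'n \<Rightarrow> real^'n) set" where
  "Vp_ball \<Omega> p N = {z \<in> Vp_space \<Omega> p. Vp_norm \<Omega> p z \<le> N}"

definition continuous_embedding :: "'a set \<Rightarrow> ('a \<Rightarrow> real) \<Rightarrow> 'a set \<Rightarrow> ('a \<Rightarrow> real) \<Rightarrow> bool" where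
  "continuous_embedding X NX Y NY \<longleftrightarrow> X \<subseteq> Y \<and> (\<exists>c>0. \<forall>u\<in>X. NY u \<le> c * NX u)"

text \<open>
  The embedding of \<open>H = H'\<close> into the dual space of \<open>V\<^sub>p \<inter> L\<^sup>r\<close> is the transpose of the
  embedding of \<open>V\<^sub>p \<inter> L\<^sup>r\<close> into \<open>H\<close>, hence no condition of its own.
\<close>

definition standing_embeddings :: "(real^'n) set \<Rightarrow> real \<Rightarrow> real \<Rightarrow> bool" where
  "standing_embeddings \<Omega> p r \<longleftrightarrow>
     continuous_embedding (Vp_space \<Omega> p) (Vp_norm \<Omega> p) (V_space \<Omega>) (V_norm \<Omega>) \<and>
     continuous_embedding (Vp_space \<Omega> p \<inter> Ltilde_space \<Omega> r) (\<lambda>u. Vp_norm \<Omega> p u + Lp_norm \<Omega> r u)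
       (H_space \<Omega>) (H_norm \<Omega>)"

text \<open>
  Membership in the Lebesgue space is part of the inequality: its left-hand side has to be finite.
\<close>

definition gagliardo_nirenberg_const :: "(real^'n) set \<Rightarrow> real \<Rightarrow> real \<Rightarrow> bool" where
  "gagliardo_nirenberg_const \<Omega> p C \<longleftrightarrow> C > 0 \<and>
     (\<forall>z\<in>V_space \<Omega>. z \<in> Lp_space \<Omega> (2 * p / (p - 1)) \<and>
        (Lp_norm \<Omega> (2 * p / (p - 1)) z)\<^sup>2
        \<le> C * V_norm \<Omega> z powr (real CARD('n) / p) * H_norm \<Omega> z powr ((2 * p - real CARD('n)) / p))"


subsection \<open>Operators\<close>

text \<open>
  An operator maps \<open>u\<close> to a functional on \<open>V\<^sub>p \<inter> L\<^sup>r\<close>, and the duality pairing is function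
  application. For \<open>r = 2\<close>, the convention \<open>0 powr 0 = 0\<close> does no harm in \<open>C_op\<close>, since the
  other factor vanishes as well.
\<close>

definition A_op :: "(real^'n) set \<Rightarrow> real \<Rightarrow> (real^'n \<Rightarrow> real^'n) \<Rightarrow> (real^'n \<Rightarrow> real^'n) \<Rightarrow> real" where
  "A_op \<Omega> p u = (\<lambda>v. LINT s|lebesgue_on \<Omega>.
     (1 + (norm (weak_gradient \<Omega> u s))\<^sup>2) powr ((p - 2) / 2)
     * (weak_gradient \<Omega> u s \<bullet> weak_gradient \<Omega> v s))"

definition B_op :: "(real^'n) set \<Rightarrow> (real^'n \<Rightarrow> real^'n) \<Rightarrow> (real^'n \<Rightarrow> real^'n) \<Rightarrow> real" where
  "B_op \<Omega> u = (\<lambda>v. LINT s|lebesgue_on \<Omega>. (weak_gradient \<Omega> u s *v u s) \<bullet> v s)"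

definition C_op :: "(real^'n) set \<Rightarrow> real \<Rightarrow> (real^'n \<Rightarrow> real^'n) \<Rightarrow> (real^'n \<Rightarrow> real^'n) \<Rightarrow> real" where
  "C_op \<Omega> r u = (\<lambda>v. LINT s|lebesgue_on \<Omega>. norm (u s) powr (r - 2) * (u s \<bullet> v s))"

definition H_op :: "(real^'n) set \<Rightarrow> real \<Rightarrow> real \<Rightarrow> real \<Rightarrow> real
    \<Rightarrow> (real^'n \<Rightarrow> real^'n) \<Rightarrow> (real^'n \<Rightarrow> real^'n) \<Rightarrow> real" where
  "H_op \<Omega> \<mu> \<beta> p r u = (\<lambda>v. \<mu> * A_op \<Omega> p u v + B_op \<Omega> u v + \<beta> * C_op \<Omega> r u v)"

definition eta_tilde :: "real \<Rightarrow> real \<Rightarrow> real \<Rightarrow> real \<Rightarrow> real" where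
  "eta_tilde d \<mu> p C =
     C powr (2 * p / (2 * p - d)) * ((2 * p - d) / (2 * p)) * (d / (\<mu> * p)) powr (d / (2 * p - d))"

end

theory Submission
  imports Defs
begin

text \<open>
  Write $z = x - y$. Since the weights $(1+|\nabla u|^2)^{(p-2)/2} \ge 1$ and $|u|^{r-2}$ are nondecreasing
  functions of the modulus,
  $\langle\mathcal A(x) - \mathcal A(y), z\rangle \ge \|z\|_V^2$ and
  $\langle\mathcal C(x) - \mathcal C(y), z\rangle \ge 0$. For the convective term,
  $(x\cdot\nabla)x - (y\cdot\nabla)y = (x\cdot\nabla)z + (z\cdot\nabla)y$, and the first
  summand contributes nothing when tested with $z$ because $x$ is divergence free. This is shown by
  approximation: for test functions $\zeta$, it is the weak form of $\nabla\cdot x = 0$ tested with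
  $|\zeta|^2$, and if $\zeta \to z$ in $V_p$, then the Poincare and Gagliardo--Nirenberg
  inequalities give $\zeta \to z$ in $L^{2p/(p-1)}$, where the trilinear form is continuous. The second summand
  is at most $\|y\|_{V_p} \|z\|_{L^{2p/(p-1)}}^2$ by the Hoelder inequality, and the
  Gagliardo--Nirenberg and Young inequalities bound it by
  $\frac\mu2 \|z\|_V^2 + \widetilde\eta N^{2p/(2p-d)} \|z\|_H^2$.
\<close>

subsection \<open>Functions of class $C^k$ and the fundamental lemma of the calculus of variations\<close>

text \<open>Two obstacles shape the proof. \<open>weak_gradient\<close> is a bare choice, so the
  gradient of \<open>x - y\<close> is the difference of the gradients only almost everywhere, and
  only because weak gradients are unique up to null sets; the bump functions and the fundamental
  lemma serve this purpose. Moreover, the weak form of div x = 0 admits only test functions, which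
  |z|^2 need not be, so z is replaced by solenoidal test functions while x stays fixed. Convergence
  in \<open>W1p_norm\<close> does not directly control the exponent 2p/(p-1): Gagliardo-Nirenberg
  bounds that norm by the V and H norms, the Poincare inequality trades the H norm for the V norm,
  and the embedding of V_p into V closes the chain. The condition p > d/2 leaves the H norm a
  positive exponent and makes 2p/d and 2p/(2p-d) admissible Young exponents;
  \<open>eta_tilde\<close> is the constant left over when the V part is weighted to cost exactly
  \<mu>/2, half of what the monotonicity of \<open>A_op\<close> provides.\<close>

lemma Ck_on_Suc_imp: "Ck_on (Suc k) S f \<Longrightarrow> Ck_on k S f"
proof (induction k arbitrary: f)
  case 0
  then show ?case
    by (auto intro!: differentiable_imp_continuous_on simp: differentiable_on_def)
       (use differentiable_at_withinI in blast)
next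
  case (Suc k)
  then have "Ck_on (Suc k) S (\<lambda>x. frechet_derivative f (at x) v)" "\<forall>x\<in>S. f differentiable (at x)" for v
    unfolding Ck_on.simps(2)[of "Suc k"] by blast+
  then show ?case using Suc.IH unfolding Ck_on.simps(2)[of k S f] by blast
qed

lemma Ck_on_const [simp]: "Ck_on k S (\<lambda>x. c)"
  by (induction k arbitrary: c) auto

lemma frechet_derivative_bounded_linear:
  assumes "bounded_linear h" "f differentiable at x"
  shows "frechet_derivative (\<lambda>x. h (f x)) (at x) = (\<lambda>v. h (frechet_derivative f (at x) v))"
  using frechet_derivative_at[OF bounded_linear.has_derivative[OF assms(1)
        assms(2)[unfolded frechet_derivative_works]]] by simp

lemma Ck_on_bounded_linear:
  assumes "bounded_linear h"
  shows "Ck_on k UNIV f \<Longrightarrow> Ck_on k UNIV (\<lambda>x. h (f x))"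
proof (induction k arbitrary: f)
  case 0
  then show ?case using assms by (auto intro: bounded_linear.continuous_on)
next
  case (Suc k)
  then show ?case
    using assms bounded_linear_imp_differentiable[OF assms]
    by (auto simp: frechet_derivative_bounded_linear intro: differentiable_compose[of h])
qed

lemma Ck_add:
  "Ck_on k UNIV f \<Longrightarrow> Ck_on k UNIV g \<Longrightarrow> Ck_on k UNIV (\<lambda>x. f x + g x)"
proof (induction k arbitrary: f g)
  case 0
  then show ?case by (auto intro: continuous_on_add)
next
  case (Suc k)
  have "frechet_derivative (\<lambda>x. f x + g x) (at x) v
      = frechet_derivative f (at x) v + frechet_derivative g (at x) v" for x v
  proof -
    have "(f has_derivative frechet_derivative f (at x)) (at x)"
      "(g has_derivative frechet_derivative g (at x)) (at x)"
      using Suc.prems by (auto simp flip: frechet_derivative_works)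
    from frechet_derivative_at[OF has_derivative_add[OF this], symmetric] show ?thesis by simp
  qed
  then show ?case using Suc by auto
qed

lemma Ck_sum:
  "(\<And>i. i \<in> I \<Longrightarrow> Ck_on k UNIV (f i)) \<Longrightarrow> Ck_on k UNIV (\<lambda>x. \<Sum>i\<in>I. f i x)"
  by (induction I rule: infinite_finite_induct) (auto intro: Ck_add)

lemma frechet_derivative_mult:
  fixes f g :: "'a::real_normed_vector \<Rightarrow> real"
  assumes "f differentiable at x" "g differentiable at x"
  shows "frechet_derivative (\<lambda>x. f x * g x) (at x)
    = (\<lambda>v. f x * frechet_derivative g (at x) v + frechet_derivative f (at x) v * g x)"
proof -
  have "(f has_derivative frechet_derivative f (at x)) (at x)"
    "(g has_derivative frechet_derivative g (at x)) (at x)"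
    using assms by (auto simp flip: frechet_derivative_works)
  from frechet_derivative_at[OF has_derivative_mult[OF this], symmetric] show ?thesis .
qed

lemma Ck_mult:
  fixes f g :: "'a::euclidean_space \<Rightarrow> real"
  shows "Ck_on k UNIV f \<Longrightarrow> Ck_on k UNIV g \<Longrightarrow> Ck_on k UNIV (\<lambda>x. f x * g x)"
proof (induction k arbitrary: f g)
  case 0
  then show ?case by (auto intro: continuous_on_mult)
next
  case (Suc k)
  \<comment> \<open>The product rule keeps one factor undifferentiated in each term, so both factors
    are also needed at order \<open>k\<close>, one below the assumption.\<close>
  have "Ck_on k UNIV f" "Ck_on k UNIV g" by (rule Suc.prems[THEN Ck_on_Suc_imp])+
  then show ?case using Suc
    by (auto simp: frechet_derivative_mult intro!: Ck_add)
qed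

lemma Ck_prod:
  fixes f :: "'i \<Rightarrow> 'a::euclidean_space \<Rightarrow> real"
  shows "(\<And>i. i \<in> I \<Longrightarrow> Ck_on k UNIV (f i)) \<Longrightarrow> Ck_on k UNIV (\<lambda>x. \<Prod>i\<in>I. f i x)"
  by (induction I rule: infinite_finite_induct) (auto intro: Ck_mult)

section \<open>Smooth bumps on boxes, built from a function that is flat at 0\<close>

text \<open>The factor \<open>inverse t ^ m\<close> makes the family closed under differentiation.\<close>

definition flat_fun :: "nat \<Rightarrow> real \<Rightarrow> real" where
  "flat_fun m t = (if t > 0 then inverse t ^ m * exp (- inverse t) else 0)"

text \<open>The exponential outgrows every power of \<open>inverse t\<close>. Applied with the power
  raised by one, this limit becomes the derivative at 0.\<close>

lemma flat_fun_tendsto_0: "(flat_fun m \<longlongrightarrow> 0) (at 0)"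
proof -
  have "((\<lambda>t::real. inverse t ^ m / exp (inverse t)) \<longlongrightarrow> 0) (at_right 0)"
    by (rule filterlim_compose[OF tendsto_power_div_exp_0 filterlim_inverse_at_top_right])
  then have "(flat_fun m \<longlongrightarrow> 0) (at_right 0)"
    by (rule Lim_transform_eventually)
       (auto simp: eventually_at_right_field flat_fun_def exp_minus field_simps intro!: exI[of _ 1])
  moreover have "(flat_fun m \<longlongrightarrow> 0) (at_left 0)"
    by (rule Lim_transform_eventually[of "\<lambda>_. 0"])
       (auto simp: eventually_at_left_field flat_fun_def intro!: exI[of _ "-1"])
  ultimately show ?thesis by (rule filterlim_split_at[rotated])
qed

lemma has_real_derivative_flat_fun:
  "(flat_fun m has_real_derivative (flat_fun (m + 2) t - real m * flat_fun (Suc m) t)) (at t)"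
proof -
  consider "t > 0" | "t < 0" | "t = 0" by linarith
  then show ?thesis
  proof cases
    case 1
    have "((\<lambda>t. inverse t ^ m * exp (- inverse t)) has_real_derivative
        (inverse t ^ (m + 2) * exp (- inverse t) - real m * (inverse t ^ Suc m * exp (- inverse t)))) (at t)"
    proof -
      have i: "(inverse has_real_derivative - (inverse t * inverse t)) (at t)"
        using DERIV_inverse[of t UNIV] 1 by simp
      \<comment> \<open>Differentiating the power produces the exponent \<open>m - Suc 0\<close> in
        truncated subtraction; for \<open>m = 0\<close> the factor \<open>real m\<close> removes
        that term anyway.\<close>
      have "m = 0 \<or> inverse t ^ m = inverse t * inverse t ^ (m - Suc 0)"
        by (cases m) auto
      then show ?thesis
        by (intro DERIV_cong[OF DERIV_mult[OF DERIV_power[OF i] DERIV_chain2[OF DERIV_exp DERIV_minus[OF i]]]])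
           (auto simp: algebra_simps)
    qed
    then have "(flat_fun m has_real_derivative
        (inverse t ^ (m + 2) * exp (- inverse t) - real m * (inverse t ^ Suc m * exp (- inverse t)))) (at t)"
      by (rule has_field_derivative_transform_within_open[of _ _ _ "{0<..}"])
         (use 1 in \<open>auto simp: flat_fun_def\<close>)
    then show ?thesis using 1 by (simp add: flat_fun_def)
  next
    case 2
    have "(flat_fun m has_real_derivative 0) (at t)"
      by (rule has_field_derivative_transform_within_open[of "\<lambda>_. 0" _ _ "{..<0}"])
         (use 2 in \<open>auto simp: flat_fun_def\<close>)
    then show ?thesis using 2 by (simp add: flat_fun_def)
  next
    case 3
    \<comment> \<open>The difference quotient of \<open>flat_fun m\<close> at 0 is
      \<open>flat_fun (Suc m)\<close>: dividing by \<open>t\<close> raises the power of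
      \<open>inverse t\<close> by one.\<close>
    have "(flat_fun m has_real_derivative 0) (at 0)"
      unfolding has_field_derivative_iff
      by (rule Lim_transform_eventually[OF flat_fun_tendsto_0[of "Suc m"]])
         (auto simp: flat_fun_def field_simps eventually_at_filter)
    then show ?thesis using 3 by (simp add: flat_fun_def)
  qed
qed

text \<open>Restricting to affine arguments makes the inner derivative the constant
  \<open>w \<bullet> v\<close>. Each differentiation then stays within combinations of the same
  family, and no chain rule of order \<open>k\<close> is required.\<close>

lemma Ck_flat_fun_affine:
  fixes w :: "'a::euclidean_space"
  shows "Ck_on k UNIV (\<lambda>x. flat_fun m (w \<bullet> x + c))"
proof (induction k arbitrary: m)
  have D: "((\<lambda>x. flat_fun m (w \<bullet> x + c)) has_derivative
      (\<lambda>v. (flat_fun (m + 2) (w \<bullet> x + c) + - real m * flat_fun (Suc m) (w \<bullet> x + c)) * (w \<bullet> v))) (at x)"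
    for m x
  proof -
    have "((\<lambda>x. w \<bullet> x + c) has_derivative (\<lambda>v. w \<bullet> v)) (at x)"
      by (auto intro!: derivative_eq_intros)
    from has_derivative_compose[OF this has_real_derivative_flat_fun[of m,
          THEN has_field_derivative_imp_has_derivative]]
    show ?thesis by simp
  qed
  {
    case 0
    show ?case using has_derivative_continuous_on[OF has_derivative_at_withinI[OF D]] by simp
  next
    case (Suc k)
    have "Ck_on k UNIV (\<lambda>x. (flat_fun (m + 2) (w \<bullet> x + c)
        + - real m * flat_fun (Suc m) (w \<bullet> x + c)) * (w \<bullet> v))" for v
      by (intro Ck_mult Ck_add Suc Ck_on_const)
    moreover have "(\<lambda>x. flat_fun m (w \<bullet> x + c)) differentiable (at x)" for x
      using D unfolding differentiable_def by blast
    ultimately show ?case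
      unfolding Ck_on.simps frechet_derivative_at[OF D, symmetric] by blast
  }
qed

text \<open>A tensor product of one-dimensional cutoffs whose parameter \<open>c\<close> controls
  steepness: as \<open>c\<close> grows, the bumps converge to the indicator of the open box while
  staying between 0 and 1. They take the place of mollified indicators.\<close>

definition box_bump :: "'a::euclidean_space \<Rightarrow> 'a \<Rightarrow> real \<Rightarrow> 'a \<Rightarrow> real" where
  "box_bump a b c x =
     (\<Prod>i\<in>Basis. flat_fun 0 (c * (x \<bullet> i - a \<bullet> i)) * flat_fun 0 (c * (b \<bullet> i - x \<bullet> i)))"

lemma flat_fun_0_bounds: "0 \<le> flat_fun 0 t" "flat_fun 0 t \<le> 1"
  by (auto simp: flat_fun_def)

lemma box_bump_bounds: "0 \<le> box_bump a b c x" "box_bump a b c x \<le> 1"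
  unfolding box_bump_def
  by (auto intro!: prod_nonneg prod_le_1 mult_nonneg_nonneg mult_le_one flat_fun_0_bounds)

lemma box_bump_eq_0:
  assumes "c > 0" "x \<notin> box a b"
  shows "box_bump a b c x = 0"
proof -
  from assms(2) obtain i where "i \<in> Basis" "a \<bullet> i \<ge> x \<bullet> i \<or> x \<bullet> i \<ge> b \<bullet> i"
    by (auto simp: mem_box)
  then have "flat_fun 0 (c * (x \<bullet> i - a \<bullet> i)) * flat_fun 0 (c * (b \<bullet> i - x \<bullet> i)) = 0"
    using assms(1) by (auto simp: flat_fun_def zero_less_mult_iff)
  then show ?thesis unfolding box_bump_def using \<open>i \<in> Basis\<close> by (auto simp: prod_zero_iff)
qed

lemma Ck_box_bump: "Ck_on k UNIV (box_bump a b c)"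
proof -
  have "box_bump a b c = (\<lambda>x. \<Prod>i\<in>Basis. flat_fun 0 ((c *\<^sub>R i) \<bullet> x + (- c * (a \<bullet> i)))
      * flat_fun 0 ((- c *\<^sub>R i) \<bullet> x + c * (b \<bullet> i)))"
    unfolding box_bump_def by (auto simp: fun_eq_iff algebra_simps inner_commute)
  then show ?thesis by (simp only:) (intro Ck_prod Ck_mult Ck_flat_fun_affine)
qed

lemma box_bump_test_function:
  assumes "c > 0" "cbox a b \<subseteq> \<Omega>"
  shows "box_bump a b c \<in> test_functions \<Omega>"
proof -
  have "{x. box_bump a b c x \<noteq> 0} \<subseteq> cbox a b"
    using box_bump_eq_0[OF assms(1)] box_subset_cbox[of a b] by blast
  then have "closure {x. box_bump a b c x \<noteq> 0} \<subseteq> cbox a b"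
    by (rule closure_minimal) (rule closed_cbox)
  then show ?thesis
    unfolding test_functions_def using assms(2) Ck_box_bump
    by (auto intro: compact_closure[THEN iffD2] bounded_subset[OF bounded_cbox] closure_subset[THEN subsetD])
qed

lemma box_bump_tendsto_indicator:
  "(\<lambda>n. box_bump a b (real (Suc n)) x) \<longlonglongrightarrow> indicator (box a b) x"
proof (cases "x \<in> box a b")
  case True
  have 1: "(\<lambda>n. flat_fun 0 (real (Suc n) * t)) \<longlonglongrightarrow> 1" if "t > 0" for t
  proof -
    have "(\<lambda>n. exp (- (inverse (real (Suc n)) * inverse t))) \<longlonglongrightarrow> exp (- (0 * inverse t))"
      by (intro tendsto_intros LIMSEQ_inverse_real_of_nat)
    then show ?thesis
      using that by (simp add: flat_fun_def)
  qed
  have "(\<lambda>n. box_bump a b (real (Suc n)) x) \<longlonglongrightarrow> (\<Prod>i\<in>(Basis::'a set). 1 * 1)"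
    unfolding box_bump_def using True by (intro tendsto_prod tendsto_mult 1) (auto simp: mem_box)
  then show ?thesis using True by simp
next
  case False
  then have "(\<lambda>n. box_bump a b (real (Suc n)) x) = (\<lambda>n. 0)" by (simp add: box_bump_eq_0)
  then show ?thesis using False by simp
qed

section \<open>The fundamental lemma, from test functions to boxes to measurable sets\<close>

lemma integral_box_eq_0_if_test_integrals_eq_0:
  fixes g :: "'a::euclidean_space \<Rightarrow> real"
  assumes \<Omega>: "\<Omega> \<in> sets lebesgue" and ab: "cbox a b \<subseteq> \<Omega>"
    and g: "g absolutely_integrable_on cbox a b"
    and z: "\<And>\<phi>. \<phi> \<in> test_functions \<Omega> \<Longrightarrow> (LINT s|lebesgue_on \<Omega>. g s * \<phi> s) = 0"
  shows "(LINT s|lebesgue. indicator (box a b) s * g s) = 0"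
proof -
  define G where "G s = indicator (cbox a b) s * g s" for s
  have G: "integrable lebesgue G"
    using g unfolding G_def set_integrable_def by simp
  have [measurable]: "box_bump a b (real (Suc n)) \<in> borel_measurable lebesgue" for n
    using Ck_box_bump[of 0 a b "real (Suc n)"]
    by (intro measurable_completion) (simp add: borel_measurable_continuous_onI)
  have [measurable]: "(indicator (box a b) :: 'a \<Rightarrow> real) \<in> borel_measurable lebesgue"
    by (intro borel_measurable_indicator) auto
  have [measurable]: "G \<in> borel_measurable lebesgue" using G by auto
  \<comment> \<open>The limit turns the test function into the indicator of the box. The majorant
    \<open>\<bar>G s\<bar>\<close> is available because the closed box lies in
    \<open>\<Omega>\<close>, where \<open>g\<close> is locally integrable; cutting \<open>g\<close>
    down to \<open>G\<close> makes it integrable on the whole space.\<close>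
  have "(\<lambda>n. LINT s|lebesgue. G s * box_bump a b (real (Suc n)) s)
      \<longlonglongrightarrow> (LINT s|lebesgue. G s * indicator (box a b) s)"
  proof (rule integral_dominated_convergence)
    show "integrable lebesgue (\<lambda>s. \<bar>G s\<bar>)" using G by simp
    show "AE s in lebesgue. (\<lambda>n. G s * box_bump a b (real (Suc n)) s) \<longlonglongrightarrow> G s * indicator (box a b) s"
      by (intro AE_I2 tendsto_mult tendsto_const box_bump_tendsto_indicator)
    show "AE s in lebesgue. norm (G s * box_bump a b (real (Suc n)) s) \<le> \<bar>G s\<bar>" for n
      using box_bump_bounds[of a b "real (Suc n)"]
      by (auto simp: abs_mult intro!: mult_right_le_one_le)
  qed measurable
  moreover have "(LINT s|lebesgue. G s * box_bump a b (real (Suc n)) s) = 0" for n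
  proof -
    have "(LINT s|lebesgue. G s * box_bump a b (real (Suc n)) s)
        = (LINT s|lebesgue. indicator \<Omega> s *\<^sub>R (g s * box_bump a b (real (Suc n)) s))"
      using ab box_bump_eq_0[of "real (Suc n)" _ a b] box_subset_cbox[of a b]
      by (intro Bochner_Integration.integral_cong) (force simp: G_def indicator_def)+
    also have "\<dots> = (LINT s|lebesgue_on \<Omega>. g s * box_bump a b (real (Suc n)) s)"
      using \<Omega> by (subst integral_restrict_space) auto
    also have "\<dots> = 0" by (intro z box_bump_test_function ab) simp
    finally show ?thesis .
  qed
  moreover have "G s * indicator (box a b) s = indicator (box a b) s * g s" for s
    using box_subset_cbox[of a b] by (auto simp: G_def indicator_def)
  ultimately show ?thesis by (simp add: LIMSEQ_const_iff)
qed



text \<open>A Dynkin argument: the sets over which \<open>h\<close> integrates to 0 are closed under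
  complements and disjoint countable unions, and boxes form an intersection-stable generator of the
  Borel sets. The vanishing then extends to Lebesgue sets and is applied to the sets where
  \<open>h\<close> is positive and where it is negative.\<close>

lemma AE_eq_0_if_box_integrals_eq_0:
  fixes h :: "'a::euclidean_space \<Rightarrow> real"
  assumes h: "integrable lebesgue h"
    and z: "\<And>c d. (LINT s|lebesgue. indicator (box c d) s * h s) = 0"
  shows "AE s in lebesgue. h s = 0"
proof -
  have int: "integrable lebesgue (\<lambda>s. indicator A s * h s)" if "A \<in> sets lebesgue" for A
    using integrable_mult_indicator[OF that h] by simp
  \<comment> \<open>Closure under complements needs the whole space, which is not a box; it is
    exhausted by the cubes \<open>?A n\<close>.\<close>
  have UNIV0: "integral\<^sup>L lebesgue h = 0"
  proof -
    let ?A = "\<lambda>n::nat. box (- (real n *\<^sub>R One)) (real n *\<^sub>R One) :: 'a set"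
    have "(\<lambda>n. LINT s|lebesgue. indicator (?A n) s * h s) \<longlonglongrightarrow> (LINT s|lebesgue. h s)"
    proof (rule integral_dominated_convergence)
      show "integrable lebesgue (\<lambda>s. \<bar>h s\<bar>)" using h by simp
      show "AE s in lebesgue. (\<lambda>n. indicator (?A n) s * h s) \<longlonglongrightarrow> h s"
      proof (rule AE_I2)
        fix s
        obtain n where n: "s \<in> ?A n" using UN_box_eq_UNIV[where 'a='a] by blast
        have "\<forall>\<^sub>F m in sequentially. indicator (?A m) s * h s = h s"
          using eventually_ge_at_top[of n]
        proof eventually_elim
          case (elim m)
          have "real n \<le> real m" using elim by simp
          then have "s \<in> ?A m" using n by (fastforce simp: mem_box)
          then show ?case by simp
        qed
        then show "(\<lambda>n. indicator (?A n) s * h s) \<longlonglongrightarrow> h s"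
          by (rule tendsto_eventually)
      qed
      show "AE s in lebesgue. norm (indicator (?A n) s * h s) \<le> \<bar>h s\<bar>" for n
        by (auto simp: indicator_def)
    next
      show "(\<lambda>s. indicator (?A n) s * h s) \<in> borel_measurable lebesgue" for n
        by (intro borel_measurable_integrable int) auto
    qed (use h in auto)
    then show ?thesis by (simp add: z LIMSEQ_const_iff)
  qed
  have borel0: "(LINT s|lebesgue. indicator A s * h s) = 0" if A: "A \<in> sets borel" for A
  proof -
    let ?E = "range (\<lambda>(a, b). box a b::'a set)"
    have "Int_stable ?E" by (auto simp: Int_stable_def box_Int_box)
    moreover have "?E \<subseteq> Pow UNIV" by simp
    moreover have "A \<in> sigma_sets UNIV ?E" using A by (simp add: borel_eq_box)
    ultimately show ?thesis
    proof (induction rule: sigma_sets_induct_disjoint)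
      case (basic A)
      then show ?case using z by auto
    next
      case empty
      then show ?case by simp
    next
      case (compl A)
      have A: "A \<in> sets lebesgue" using compl(1) by (auto simp: borel_eq_box)
      have "(LINT s|lebesgue. indicator (UNIV - A) s * h s)
          = (LINT s|lebesgue. h s - indicator A s * h s)"
        by (intro Bochner_Integration.integral_cong) (auto simp: indicator_def)
      also have "\<dots> = 0" using compl h int[OF A] UNIV0 by simp
      finally show ?case .
    next
      case (union A)
      have "sigma_sets UNIV ?E = sets borel" by (simp add: borel_eq_box)
      with union(2) have "A i \<in> sets borel" for i by blast
      then have A: "A i \<in> sets lebesgue" for i by simp
      have "set_lebesgue_integral lebesgue (\<Union>i. A i) h = (\<Sum>i. set_lebesgue_integral lebesgue (A i) h)"
        using A union(1) int[of "\<Union>i. A i"]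
        by (intro lebesgue_integral_countable_add) (auto simp: disjoint_family_on_def set_integrable_def)
      then show ?case using union(3) by (simp add: set_lebesgue_integral_def)
    qed
  qed
  \<comment> \<open>Every Lebesgue set is an F-sigma set up to a null set, and the integral does not
    see the null set.\<close>
  have leb0: "(LINT s|lebesgue. indicator A s * h s) = 0" if "A \<in> sets lebesgue" for A
  proof -
    obtain C T where CT: "fsigma C" "T \<in> null_sets lebesgue" "C \<union> T = A"
      using lebesgue_set_almost_fsigma[OF \<open>A \<in> sets lebesgue\<close>] .
    have C: "C \<in> sets borel" using CT(1) by (cases rule: fsigma.cases) auto
    have "AE s in lebesgue. s \<notin> T" using CT(2) by (rule AE_not_in)
    then have "AE s in lebesgue. indicator A s * h s = indicator C s * h s"
      by eventually_elim (use CT(3) in \<open>auto simp: indicator_def\<close>)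
    then have "(LINT s|lebesgue. indicator A s * h s) = (LINT s|lebesgue. indicator C s * h s)"
      using \<open>A \<in> sets lebesgue\<close> C
      by (intro integral_cong_AE borel_measurable_integrable int) auto
    then show ?thesis using borel0[OF C] by simp
  qed
  have [measurable]: "h \<in> borel_measurable lebesgue" using h by auto
  have "{s \<in> space lebesgue. h s > 0} \<in> sets lebesgue" "{s \<in> space lebesgue. h s < 0} \<in> sets lebesgue"
    by measurable
  then have P: "{s. h s > 0} \<in> sets lebesgue" "{s. h s < 0} \<in> sets lebesgue" by simp_all
  \<comment> \<open>On its positivity set \<open>h\<close> is a nonnegative integrand with integral
    0, so it vanishes there almost everywhere.\<close>
  have "AE s in lebesgue. indicator {s. h s > 0} s * h s = 0"
    using leb0[OF P(1)] int[OF P(1)]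
    by (subst (asm) integral_nonneg_eq_0_iff_AE) (auto simp: indicator_def)
  moreover have "(LINT s|lebesgue. - (indicator {s. h s < 0} s * h s)) = 0"
    using leb0[OF P(2)] by simp
  then have "AE s in lebesgue. - (indicator {s. h s < 0} s * h s) = 0"
    using int[OF P(2)]
    by (subst (asm) integral_nonneg_eq_0_iff_AE) (auto simp: indicator_def)
  ultimately show ?thesis by eventually_elim (auto simp: indicator_def split: if_splits)
qed

text \<open>Since \<open>g\<close> is only locally integrable, the global statement is applied to
  \<open>g\<close> cut off to boxes inside \<open>\<Omega>\<close>. An open set is a countable union
  of closed boxes, so the exceptional null sets add up to a null set.\<close>

lemma AE_eq_0_if_test_integrals_eq_0:
  fixes g :: "'a::euclidean_space \<Rightarrow> real"
  assumes \<Omega>: "open \<Omega>"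
    and g: "\<And>K. compact K \<Longrightarrow> K \<subseteq> \<Omega> \<Longrightarrow> g absolutely_integrable_on K"
    and z: "\<And>\<phi>. \<phi> \<in> test_functions \<Omega> \<Longrightarrow> (LINT s|lebesgue_on \<Omega>. g s * \<phi> s) = 0"
  shows "AE s in lebesgue_on \<Omega>. g s = 0"
proof -
  have L: "\<Omega> \<in> sets lebesgue" using \<Omega> by auto
  have box: "AE s in lebesgue. s \<in> cbox a b \<longrightarrow> g s = 0" if ab: "cbox a b \<subseteq> \<Omega>" for a b
  proof -
    have gab: "g absolutely_integrable_on box a b"
      using g[OF compact_cbox ab] by (rule set_integrable_subset) (auto simp: box_subset_cbox)
    have "AE s in lebesgue. indicator (box a b) s * g s = 0"
    proof (rule AE_eq_0_if_box_integrals_eq_0)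
      show "integrable lebesgue (\<lambda>s. indicator (box a b) s * g s)"
        using gab by (simp add: set_integrable_def)
      fix c d :: 'a
      \<comment> \<open>Intersecting with the cutoff box gives a box again. If it is nonempty, its
        closure is the closed box, which remains inside \<open>cbox a b\<close> and hence inside
        \<open>\<Omega>\<close>, as admissible bumps require.\<close>
      obtain e f where ef: "box a b \<inter> box c d = box e f" by (auto simp: box_Int_box)
      have "(LINT s|lebesgue. indicator (box c d) s * (indicator (box a b) s * g s))
          = (LINT s|lebesgue. indicator (box e f) s * g s)"
        by (intro Bochner_Integration.integral_cong) (auto simp: ef[symmetric] indicator_def)
      also have "\<dots> = 0"
      proof (cases "box e f = {}")
        case False
        have "cbox e f = closure (box e f)" using False by (simp add: closure_box)
        also have "\<dots> \<subseteq> cbox a b"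
          using ef box_subset_cbox[of a b] by (intro closure_minimal) auto
        finally have "cbox e f \<subseteq> \<Omega>" using ab by simp
        then show ?thesis
          by (intro integral_box_eq_0_if_test_integrals_eq_0[OF L] g z) auto
      qed simp
      finally show "(LINT s|lebesgue. indicator (box c d) s * (indicator (box a b) s * g s)) = 0" .
    qed
    \<comment> \<open>The covering of \<open>\<Omega>\<close> is by closed boxes, whereas the bumps
      detect only open ones; the boundary between them is negligible.\<close>
    moreover have "AE s in lebesgue. s \<notin> cbox a b - box a b"
      using negligible_frontier_interval[of a b] by (simp only: negligible_iff_null_sets AE_not_in)
    ultimately show ?thesis by eventually_elim (auto simp: indicator_def)
  qed
  obtain D where D: "countable D" "D \<subseteq> Pow \<Omega>" "\<And>X. X \<in> D \<Longrightarrow> \<exists>a b. X = cbox a b" "\<Union>D = \<Omega>"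
    using open_countable_Union_open_cbox[OF \<Omega>] by metis
  have "AE s in lebesgue. \<forall>X\<in>D. s \<in> X \<longrightarrow> g s = 0"
    using D box by (subst AE_ball_countable) (auto, blast)
  then show ?thesis
    using L D(4) by (subst AE_restrict_space_iff) (auto elim!: eventually_mono)
qed

subsection \<open>Hoelder inequalities\<close>

text \<open>Young's inequality is applied pointwise after normalising both functions to norm 1. If
  one norm vanishes, normalisation is impossible, but then the product is 0 almost
  everywhere.\<close>

lemma Holder_integral:
  fixes f g :: "'a \<Rightarrow> real"
  assumes pq: "p > 1" "q > 1" "1 / p + 1 / q = 1"
    and [measurable]: "f \<in> borel_measurable M" "g \<in> borel_measurable M"
    and nn: "\<And>s. f s \<ge> 0" "\<And>s. g s \<ge> 0"
    and f: "integrable M (\<lambda>s. f s powr p)" and g: "integrable M (\<lambda>s. g s powr q)"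
  shows "integrable M (\<lambda>s. f s * g s)"
    and "(LINT s|M. f s * g s) \<le> (LINT s|M. f s powr p) powr (1 / p) * (LINT s|M. g s powr q) powr (1 / q)"
proof -
  show int: "integrable M (\<lambda>s. f s * g s)"
  proof (rule Bochner_Integration.integrable_bound)
    show "integrable M (\<lambda>s. f s powr p / p + g s powr q / q)" using f g by auto
    show "AE s in M. norm (f s * g s) \<le> norm (f s powr p / p + g s powr q / q)"
      using Youngs_inequality[OF pq nn] nn pq by (auto simp: abs_mult)
  qed measurable
  define F where "F = (LINT s|M. f s powr p)"
  define G where "G = (LINT s|M. g s powr q)"
  have FG: "F \<ge> 0" "G \<ge> 0" unfolding F_def G_def by auto
  have "(LINT s|M. f s * g s) \<le> F powr (1 / p) * G powr (1 / q)"
  proof (cases "F = 0 \<or> G = 0")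
    case True
    then have "AE s in M. f s * g s = 0"
    proof
      assume "F = 0"
      then have "AE s in M. f s powr p = 0"
        using f unfolding F_def by (subst (asm) integral_nonneg_eq_0_iff_AE) auto
      then show ?thesis by eventually_elim auto
    next
      assume "G = 0"
      then have "AE s in M. g s powr q = 0"
        using g unfolding G_def by (subst (asm) integral_nonneg_eq_0_iff_AE) auto
      then show ?thesis by eventually_elim auto
    qed
    then have "(LINT s|M. f s * g s) = 0" by (rule integral_eq_zero_AE)
    then show ?thesis by simp
  next
    case False
    then have pos: "F > 0" "G > 0" using FG by auto
    define A where "A = F powr (1 / p)"
    define B where "B = G powr (1 / q)"
    have AB: "A > 0" "B > 0" "A powr p = F" "B powr q = G"
      using pos pq by (auto simp: A_def B_def powr_powr)
    have "f s * g s \<le> A * B * (f s powr p / (F * p) + g s powr q / (G * q))" for s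
    proof -
      have "(f s / A) * (g s / B) \<le> (f s / A) powr p / p + (g s / B) powr q / q"
        using AB nn by (intro Youngs_inequality pq) auto
      also have "\<dots> = f s powr p / (F * p) + g s powr q / (G * q)"
        using AB nn by (simp add: powr_divide)
      finally show ?thesis using AB by (simp add: field_simps)
    qed
    then have "(LINT s|M. f s * g s) \<le> (LINT s|M. A * B * (f s powr p / (F * p) + g s powr q / (G * q)))"
      using int f g by (intro integral_mono) auto
    also have "\<dots> = A * B * (F / (F * p) + G / (G * q))"
      using f g by (simp add: F_def G_def)
    also have "F / (F * p) + G / (G * q) = 1" using pos pq by simp
    finally show ?thesis by (simp add: A_def B_def)
  qed
  then show "(LINT s|M. f s * g s) \<le> (LINT s|M. f s powr p) powr (1 / p) * (LINT s|M. g s powr q) powr (1 / q)"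
    by (simp add: F_def G_def)
qed

lemma Lp_norm_nonneg: "Lp_norm \<Omega> p u \<ge> 0"
  by (simp add: Lp_norm_def)

lemma Lp_norm_powr:
  assumes "p > 0"
  shows "Lp_norm \<Omega> p u powr p = (LINT s|lebesgue_on \<Omega>. norm (u s) powr p)"
  using assms by (simp add: Lp_norm_def powr_powr)

lemma Lp_spaceD:
  assumes "u \<in> Lp_space \<Omega> p"
  shows "u \<in> borel_measurable (lebesgue_on \<Omega>)" "integrable (lebesgue_on \<Omega>) (\<lambda>s. norm (u s) powr p)"
  using assms by (auto simp: Lp_space_def)

lemma Holder_Lp:
  assumes pq: "p > 1" "q > 1" "1 / p + 1 / q = 1"
    and u: "u \<in> Lp_space \<Omega> p" and v: "v \<in> Lp_space \<Omega> q"
  shows "integrable (lebesgue_on \<Omega>) (\<lambda>s. norm (u s) * norm (v s))"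
    and "(LINT s|lebesgue_on \<Omega>. norm (u s) * norm (v s)) \<le> Lp_norm \<Omega> p u * Lp_norm \<Omega> q v"
proof -
  have [measurable]: "u \<in> borel_measurable (lebesgue_on \<Omega>)" "v \<in> borel_measurable (lebesgue_on \<Omega>)"
    using u v by (auto dest: Lp_spaceD)
  note H = Holder_integral[OF pq, of "\<lambda>s. norm (u s)" "lebesgue_on \<Omega>" "\<lambda>s. norm (v s)"]
  show "integrable (lebesgue_on \<Omega>) (\<lambda>s. norm (u s) * norm (v s))"
    using Lp_spaceD[OF u] Lp_spaceD[OF v] by (intro H) auto
  show "(LINT s|lebesgue_on \<Omega>. norm (u s) * norm (v s)) \<le> Lp_norm \<Omega> p u * Lp_norm \<Omega> q v"
    unfolding Lp_norm_def using Lp_spaceD[OF u] Lp_spaceD[OF v] by (intro H) auto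
qed

text \<open>The exponents are $p$, $2p'$ and $2p'$, where $p' = p/(p-1)$ is the conjugate exponent.\<close>

lemma Holder_Lp_triple:
  assumes p: "p > 1"
    and G: "G \<in> Lp_space \<Omega> p"
    and u: "u \<in> Lp_space \<Omega> (2 * p / (p - 1))" and v: "v \<in> Lp_space \<Omega> (2 * p / (p - 1))"
  shows "integrable (lebesgue_on \<Omega>) (\<lambda>s. norm (G s) * (norm (u s) * norm (v s)))"
    and "(LINT s|lebesgue_on \<Omega>. norm (G s) * (norm (u s) * norm (v s)))
      \<le> Lp_norm \<Omega> p G * (Lp_norm \<Omega> (2 * p / (p - 1)) u * Lp_norm \<Omega> (2 * p / (p - 1)) v)"
proof -
  define q where "q = p / (p - 1)"
  have q: "q > 1" "1 / p + 1 / q = 1" "2 * p / (p - 1) = 2 * q"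
    using p by (auto simp: q_def field_simps)
  note u = u[unfolded q(3)] and v = v[unfolded q(3)]
  have [measurable]: "u \<in> borel_measurable (lebesgue_on \<Omega>)" "v \<in> borel_measurable (lebesgue_on \<Omega>)"
    using u v by (auto dest: Lp_spaceD)
  define w where "w s = norm (u s) * norm (v s)" for s

  have wq: "norm (w s) powr q = norm (u s) powr q * norm (v s) powr q" for s
    by (simp add: w_def powr_mult)
  note CS = Holder_integral[of 2 2 "\<lambda>s. norm (u s) powr q" "lebesgue_on \<Omega>" "\<lambda>s. norm (v s) powr q"]
  have w: "w \<in> Lp_space \<Omega> q"
    unfolding Lp_space_def wq mem_Collect_eq
  proof
    show "w \<in> borel_measurable (lebesgue_on \<Omega>)" unfolding w_def by measurable
    show "integrable (lebesgue_on \<Omega>) (\<lambda>s. norm (u s) powr q * norm (v s) powr q)"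
      using Lp_spaceD[OF u] Lp_spaceD[OF v] by (intro CS) (auto simp: powr_powr mult.commute)
  qed
  have "(LINT s|lebesgue_on \<Omega>. norm (w s) powr q)
      \<le> (LINT s|lebesgue_on \<Omega>. (norm (u s) powr q) powr 2) powr (1 / 2)
        * (LINT s|lebesgue_on \<Omega>. (norm (v s) powr q) powr 2) powr (1 / 2)"
    unfolding wq using Lp_spaceD[OF u] Lp_spaceD[OF v]
    by (intro CS) (auto simp: powr_powr mult.commute)
  then have "(LINT s|lebesgue_on \<Omega>. norm (w s) powr q) powr (1 / q)
      \<le> ((LINT s|lebesgue_on \<Omega>. (norm (u s) powr q) powr 2) powr (1 / 2)
        * (LINT s|lebesgue_on \<Omega>. (norm (v s) powr q) powr 2) powr (1 / 2)) powr (1 / q)"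
    using q by (intro powr_mono2) auto
  then have wn: "Lp_norm \<Omega> q w \<le> Lp_norm \<Omega> (2 * q) u * Lp_norm \<Omega> (2 * q) v"
    by (simp add: Lp_norm_def powr_powr powr_mult mult.commute)
  note H = Holder_Lp[OF p q(1,2) G w]
  have nw: "norm (w s) = norm (u s) * norm (v s)" for s by (simp add: w_def)
  show "integrable (lebesgue_on \<Omega>) (\<lambda>s. norm (G s) * (norm (u s) * norm (v s)))"
    using H(1) unfolding nw .
  have "Lp_norm \<Omega> p G * Lp_norm \<Omega> q w \<le> Lp_norm \<Omega> p G * (Lp_norm \<Omega> (2 * q) u * Lp_norm \<Omega> (2 * q) v)"
    by (intro mult_left_mono wn Lp_norm_nonneg)
  with H(2) show "(LINT s|lebesgue_on \<Omega>. norm (G s) * (norm (u s) * norm (v s)))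
      \<le> Lp_norm \<Omega> p G * (Lp_norm \<Omega> (2 * p / (p - 1)) u * Lp_norm \<Omega> (2 * p / (p - 1)) v)"
    unfolding nw q(3) by linarith
qed

section \<open>Lebesgue spaces under differences and under changes on null sets\<close>

lemma powr_add_le:
  fixes a b p :: real
  assumes "a \<ge> 0" "b \<ge> 0" "p \<ge> 0"
  shows "(a + b) powr p \<le> 2 powr p * (a powr p + b powr p)"
proof -
  \<comment> \<open>Bounding by twice the maximum avoids convexity, so that exponents below 1 are
    covered as well; this matters for the exponent (p-2)/2 in the weight of
    \<open>A_op\<close>.\<close>
  have "(a + b) powr p \<le> (2 * max a b) powr p"
    using assms by (intro powr_mono2) auto
  also have "\<dots> = 2 powr p * max a b powr p"
    using assms by (simp add: powr_mult)
  also have "max a b powr p \<le> a powr p + b powr p" by (auto simp: max_def)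
  finally show ?thesis by simp
qed

lemma norm_diff_powr_le:
  fixes a b :: "'a::real_normed_vector"
  assumes "p \<ge> 0"
  shows "norm (a - b) powr p \<le> 2 powr p * (norm a powr p + norm b powr p)"
proof -
  have "norm (a - b) powr p \<le> (norm a + norm b) powr p"
    using assms by (intro powr_mono2 norm_triangle_ineq4) auto
  also have "\<dots> \<le> 2 powr p * (norm a powr p + norm b powr p)"
    using assms by (intro powr_add_le) auto
  finally show ?thesis .
qed

text \<open>A quasi-triangle inequality stands in for Minkowski's. It suffices because only
  membership and smallness up to a constant are drawn from it.\<close>

lemma Lp_space_diff:
  assumes u: "u \<in> Lp_space \<Omega> p" and v: "v \<in> Lp_space \<Omega> p" and p: "p \<ge> 0"
  shows "(\<lambda>s. u s - v s) \<in> Lp_space \<Omega> p"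
    and "(LINT s|lebesgue_on \<Omega>. norm (u s - v s) powr p)
      \<le> 2 powr p * ((LINT s|lebesgue_on \<Omega>. norm (u s) powr p) + (LINT s|lebesgue_on \<Omega>. norm (v s) powr p))"
proof -
  have [measurable]: "u \<in> borel_measurable (lebesgue_on \<Omega>)" "v \<in> borel_measurable (lebesgue_on \<Omega>)"
    using u v by (auto dest: Lp_spaceD)
  have int: "integrable (lebesgue_on \<Omega>) (\<lambda>s. 2 powr p * (norm (u s) powr p + norm (v s) powr p))"
    using Lp_spaceD[OF u] Lp_spaceD[OF v] by auto
  have d: "integrable (lebesgue_on \<Omega>) (\<lambda>s. norm (u s - v s) powr p)"
    using norm_diff_powr_le[OF p]
    by (intro Bochner_Integration.integrable_bound[OF int]) (auto intro!: AE_I2)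
  then show "(\<lambda>s. u s - v s) \<in> Lp_space \<Omega> p" unfolding Lp_space_def by auto
  have "(LINT s|lebesgue_on \<Omega>. norm (u s - v s) powr p)
      \<le> (LINT s|lebesgue_on \<Omega>. 2 powr p * (norm (u s) powr p + norm (v s) powr p))"
    using norm_diff_powr_le[OF p] by (intro integral_mono d int) auto
  also have "\<dots> = 2 powr p * ((LINT s|lebesgue_on \<Omega>. norm (u s) powr p) + (LINT s|lebesgue_on \<Omega>. norm (v s) powr p))"
    using Lp_spaceD[OF u] Lp_spaceD[OF v] by simp
  finally show "(LINT s|lebesgue_on \<Omega>. norm (u s - v s) powr p)
      \<le> 2 powr p * ((LINT s|lebesgue_on \<Omega>. norm (u s) powr p) + (LINT s|lebesgue_on \<Omega>. norm (v s) powr p))" .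
qed

text \<open>Completeness of Lebesgue measure, carried over to \<open>S\<close> through extension by
  zero. It makes the chosen \<open>weak_gradient\<close> inherit measurability from any weak
  gradient known to lie in the Lebesgue space.\<close>

lemma borel_measurable_lebesgue_on_AE:
  fixes f g :: "'a::euclidean_space \<Rightarrow> 'b::euclidean_space"
  assumes S: "S \<in> sets lebesgue" and f: "f \<in> borel_measurable (lebesgue_on S)"
    and ae: "AE s in lebesgue_on S. f s = g s"
  shows "g \<in> borel_measurable (lebesgue_on S)"
proof -
  have "(\<lambda>s. indicator S s *\<^sub>R f s) \<in> borel_measurable lebesgue"
    using f S by (subst (asm) borel_measurable_restrict_space_iff) auto
  moreover have "AE s in lebesgue. indicator S s *\<^sub>R f s = indicator S s *\<^sub>R g s"
    using ae S by (subst (asm) AE_restrict_space_iff) (auto simp: indicator_def elim: eventually_mono)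
  ultimately have "(\<lambda>s. indicator S s *\<^sub>R g s) \<in> borel_measurable lebesgue"
    by (rule borel_measurable_AE)
  then show ?thesis using S by (subst borel_measurable_restrict_space_iff) auto
qed

lemma Lp_space_AE:
  fixes f g :: "'a::euclidean_space \<Rightarrow> 'b::euclidean_space"
  assumes S: "\<Omega> \<in> sets lebesgue" and f: "f \<in> Lp_space \<Omega> p"
    and ae: "AE s in lebesgue_on \<Omega>. f s = g s"
  shows "g \<in> Lp_space \<Omega> p"
proof -
  have g: "g \<in> borel_measurable (lebesgue_on \<Omega>)"
    by (rule borel_measurable_lebesgue_on_AE[OF S Lp_spaceD(1)[OF f] ae])
  have "integrable (lebesgue_on \<Omega>) (\<lambda>s. norm (f s) powr p) = integrable (lebesgue_on \<Omega>) (\<lambda>s. norm (g s) powr p)"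
    using ae Lp_spaceD(1)[OF f] g by (intro integrable_cong_AE) (auto elim!: eventually_mono)
  then show ?thesis using g Lp_spaceD(2)[OF f] by (auto simp: Lp_space_def)
qed

lemma Lp_norm_AE:
  fixes f g :: "'a::euclidean_space \<Rightarrow> 'b::euclidean_space"
  assumes S: "\<Omega> \<in> sets lebesgue" and f: "f \<in> borel_measurable (lebesgue_on \<Omega>)"
    and ae: "AE s in lebesgue_on \<Omega>. f s = g s"
  shows "Lp_norm \<Omega> p f = Lp_norm \<Omega> p g"
proof -
  have [measurable]: "g \<in> borel_measurable (lebesgue_on \<Omega>)"
    by (rule borel_measurable_lebesgue_on_AE[OF S f ae])
  have "(LINT s|lebesgue_on \<Omega>. norm (f s) powr p) = (LINT s|lebesgue_on \<Omega>. norm (g s) powr p)"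
    using ae f by (intro integral_cong_AE) (auto elim!: eventually_mono)
  then show ?thesis by (simp add: Lp_norm_def)
qed

subsection \<open>Weak gradients\<close>

lemma integrable_continuous_compact_support:
  fixes f :: "'a::euclidean_space \<Rightarrow> 'b::{banach,second_countable_topology}"
  assumes "continuous_on UNIV f" "compact K" "\<And>x. x \<notin> K \<Longrightarrow> f x = 0"
  shows "integrable lborel f"
proof -
  have "integrable lborel (\<lambda>x. indicator K x *\<^sub>R f x)"
    using assms by (intro borel_integrable_compact) (auto intro: continuous_on_subset)
  moreover have "(\<lambda>x. indicator K x *\<^sub>R f x) = f" using assms by (auto simp: indicator_def)
  ultimately show ?thesis by simp
qed

lemma integrable_lebesgue_lborel:
  fixes f :: "'a::euclidean_space \<Rightarrow> 'b::{banach,second_countable_topology}"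
  shows "integrable lborel f \<Longrightarrow> integrable lebesgue f"
  by (subst integrable_completion) auto

text \<open>Difference quotients have integral zero by translation invariance, and they converge dominatedly.\<close>

lemma integral_directional_derivative_eq_0:
  fixes f :: "'a::euclidean_space \<Rightarrow> real"
  assumes f: "\<And>x. f differentiable (at x)"
    and c: "continuous_on UNIV (\<lambda>x. frechet_derivative f (at x) v)"
    and K: "compact K" "\<And>x. x \<notin> K \<Longrightarrow> f x = 0"
  shows "(LINT x|lebesgue. frechet_derivative f (at x) v) = 0"
proof -
  define D where "D x = frechet_derivative f (at x) v" for x
  have cf: "continuous_on UNIV f"
    using f by (intro differentiable_imp_continuous_on) (auto simp: differentiable_on_def)
  obtain R where R: "\<And>x. x \<in> K \<Longrightarrow> norm x \<le> R"
    using compact_imp_bounded[OF K(1)] by (auto simp: bounded_iff)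
  \<comment> \<open>One \<open>norm v\<close> covers the points whose shift may still meet
    \<open>K\<close>; the second covers the intermediate points of the mean value theorem. Outside
    the ball of radius \<open>R + norm v\<close> the difference quotients are 0.\<close>
  define L where "L = cball (0::'a) (R + norm v + norm v)"
  have L: "compact L" unfolding L_def by simp
  have cD: "continuous_on UNIV D" using c by (simp add: D_def[abs_def])
  obtain B where B: "\<And>x. x \<in> L \<Longrightarrow> \<bar>D x\<bar> \<le> B"
    using compact_imp_bounded[OF compact_continuous_image[OF continuous_on_subset[OF cD] L]]
    by (auto simp: bounded_iff)
  have line: "((\<lambda>t. f (x + t *\<^sub>R v)) has_real_derivative D (x + t *\<^sub>R v)) (at t)" for x t
  proof -
    have "((\<lambda>t. x + t *\<^sub>R v) has_derivative (\<lambda>t. t *\<^sub>R v)) (at t)"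
      by (auto intro!: derivative_eq_intros)
    moreover have "(f has_derivative frechet_derivative f (at (x + t *\<^sub>R v))) (at (x + t *\<^sub>R v))"
      using f by (simp flip: frechet_derivative_works)
    ultimately have "((\<lambda>t. f (x + t *\<^sub>R v)) has_derivative
        (\<lambda>s. frechet_derivative f (at (x + t *\<^sub>R v)) (s *\<^sub>R v))) (at t)"
      by (rule has_derivative_compose)
    moreover have "frechet_derivative f (at (x + t *\<^sub>R v)) (s *\<^sub>R v) = D (x + t *\<^sub>R v) * s" for s
      using linear_frechet_derivative[OF f] by (simp add: D_def linear_cmul)
    ultimately show ?thesis by (simp add: has_field_derivative_def)
  qed
  define q where "q n x = (f (x + inverse (real (Suc n)) *\<^sub>R v) - f x) / inverse (real (Suc n))" for n x
  have cq: "continuous_on UNIV (q n)" for n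
    unfolding q_def using cf
    by (intro continuous_intros continuous_on_compose2[OF cf]) auto
  have intf: "integrable lborel f" using cf K by (rule integrable_continuous_compact_support)
  have bound: "\<bar>q n x\<bar> \<le> indicator L x * B" for n x
  proof (cases "x \<in> cball 0 (R + norm v)")
    case True
    define t where "t = inverse (real (Suc n))"
    have t: "0 < t" "t \<le> 1" by (auto simp: t_def inverse_le_1_iff)
    \<comment> \<open>The difference quotient equals \<open>D\<close> at an intermediate point of
      \<open>L\<close>, where \<open>B\<close> bounds it uniformly in \<open>n\<close>.\<close>
    obtain z where z: "z > 0" "z < t" "f (x + t *\<^sub>R v) - f (x + 0 *\<^sub>R v) = (t - 0) * D (x + z *\<^sub>R v)"
      using MVT2[of 0 t "\<lambda>t. f (x + t *\<^sub>R v)" "\<lambda>t. D (x + t *\<^sub>R v)"] t line by auto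
    have "norm (z *\<^sub>R v) \<le> norm v" using z t by (simp add: mult_left_le_one_le)
    then have "x + z *\<^sub>R v \<in> L" using True norm_triangle_ineq[of x "z *\<^sub>R v"] by (auto simp: L_def)
    moreover have "x \<in> L" using True norm_ge_zero[of v] by (simp add: L_def del: norm_ge_zero)
    moreover have "q n x = (f (x + t *\<^sub>R v) - f x) / t" unfolding q_def t_def ..
    then have "q n x = D (x + z *\<^sub>R v)" using z t by simp
    ultimately show ?thesis using B by simp
  next
    case False
    have "norm x \<le> norm (x + inverse (real (Suc n)) *\<^sub>R v) + norm (inverse (real (Suc n)) *\<^sub>R v)"
      using norm_triangle_ineq4[of "x + inverse (real (Suc n)) *\<^sub>R v" "inverse (real (Suc n)) *\<^sub>R v"] by simp
    moreover have "norm (inverse (real (Suc n)) *\<^sub>R v) \<le> norm v"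
      by (simp add: divide_inverse[symmetric] mult_left_le_one_le inverse_le_1_iff)
    ultimately have "x \<notin> K" "x + inverse (real (Suc n)) *\<^sub>R v \<notin> K"
      using False R[of x] R[of "x + inverse (real (Suc n)) *\<^sub>R v"] norm_ge_zero[of v] by auto
    then have "q n x = 0" using K(2) by (simp add: q_def)
    moreover have "B \<ge> 0 \<or> L = {}" using B by (metis abs_ge_zero ex_in_conv order_trans)
    ultimately show ?thesis by (auto simp: indicator_def)
  qed
  have "(\<lambda>n. LINT x|lborel. q n x) \<longlonglongrightarrow> (LINT x|lborel. D x)"
  proof (rule integral_dominated_convergence)
    show "integrable lborel (\<lambda>x. indicator L x * B)"
      using borel_integrable_compact[OF L, of "\<lambda>_. B"] by simp
    show "AE x in lborel. norm (q n x) \<le> indicator L x * B" for n using bound by simp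
    show "AE x in lborel. (\<lambda>n. q n x) \<longlonglongrightarrow> D x"
    proof (rule AE_I2)
      fix x
      have "((\<lambda>h. (f (x + h *\<^sub>R v) - f x) / h) \<longlongrightarrow> D x) (at 0)"
        using line[of x 0] by (simp add: has_field_derivative_iff)
      moreover have "filterlim (\<lambda>n. inverse (real (Suc n))) (at 0) sequentially"
        unfolding filterlim_at using LIMSEQ_inverse_real_of_nat by simp
      ultimately show "(\<lambda>n. q n x) \<longlonglongrightarrow> D x"
        unfolding q_def by (rule filterlim_compose)
    qed
  qed (use cq cD in \<open>auto intro: borel_measurable_continuous_onI\<close>)
  moreover have "(LINT x|lborel. q n x) = 0" for n
  proof -
    define w where "w = inverse (real (Suc n)) *\<^sub>R v"
    have "(LINT x|lborel. f x) = (LINT x|distr lborel borel ((+) w). f x)"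
      by (simp add: lborel_distr_plus)
    also have "\<dots> = (LINT x|lborel. f (w + x))"
      using cf by (intro integral_distr) (auto intro: borel_measurable_continuous_onI)
    finally have eq: "(LINT x|lborel. f (x + w)) = (LINT x|lborel. f x)" by (simp add: add.commute)
    have "integrable lborel (\<lambda>x. f (x + w))"
    proof (rule integrable_continuous_compact_support)
      show "compact ((\<lambda>x. x - w) ` K)"
        using K(1) by (intro compact_continuous_image continuous_intros)
      show "f (x + w) = 0" if "x \<notin> (\<lambda>x. x - w) ` K" for x
        using that by (intro K(2)) force
      show "continuous_on UNIV (\<lambda>x. f (x + w))"
        by (intro continuous_intros continuous_on_compose2[OF cf]) auto
    qed
    then have "(LINT x|lborel. (f (x + w) - f x) / inverse (real (Suc n))) = 0"
      using intf eq by (simp del: of_nat_Suc)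
    then show ?thesis unfolding q_def w_def .
  qed
  ultimately have "(LINT x|lborel. D x) = 0" by (simp add: LIMSEQ_const_iff)
  then show ?thesis
    using cD unfolding D_def[symmetric]
    by (subst integral_completion) (auto intro: borel_measurable_continuous_onI)
qed

lemma test_functionD:
  assumes "\<phi> \<in> test_functions \<Omega>"
  shows "Ck_on k UNIV \<phi>" "continuous_on UNIV \<phi>" "\<phi> differentiable (at x)"
    "continuous_on UNIV (\<lambda>x. frechet_derivative \<phi> (at x) v)"
proof -
  show C: "Ck_on k UNIV \<phi>" for k using assms by (auto simp: test_functions_def)
  show "continuous_on UNIV \<phi>" using C[of 0] by simp
  show "\<phi> differentiable (at x)" "continuous_on UNIV (\<lambda>x. frechet_derivative \<phi> (at x) v)"
    using C[of 1] by auto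
qed

lemma test_function_support:
  assumes "\<phi> \<in> test_functions \<Omega>"
  obtains K where "compact K" "K \<subseteq> \<Omega>" "\<And>x. x \<notin> K \<Longrightarrow> \<phi> x = 0"
    "\<And>x. x \<notin> K \<Longrightarrow> frechet_derivative \<phi> (at x) = (\<lambda>v. 0)"
proof
  let ?K = "closure {x. \<phi> x \<noteq> 0}"
  show "compact ?K" "?K \<subseteq> \<Omega>" using assms by (auto simp: test_functions_def)
  show z: "\<phi> x = 0" if "x \<notin> ?K" for x
    using that subsetD[OF closure_subset, of x "{x. \<phi> x \<noteq> 0}"] by blast
  show "frechet_derivative \<phi> (at x) = (\<lambda>v. 0)" if "x \<notin> ?K" for x
  proof -
    have "frechet_derivative \<phi> (at x) = frechet_derivative (\<lambda>_. 0) (at x)"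
      by (rule frechet_derivative_transform_within_open[of _ _ "- ?K"])
         (use that z test_functionD(3)[OF assms] in blast)+
    then show ?thesis by simp
  qed
qed

lemma continuous_absolutely_integrable_on_compact:
  fixes f :: "'a::euclidean_space \<Rightarrow> 'b::euclidean_space"
  assumes "continuous_on UNIV f" "compact K"
  shows "f absolutely_integrable_on K"
proof -
  have "integrable lborel (\<lambda>x. indicator K x *\<^sub>R f x)"
    using assms by (intro borel_integrable_compact) (auto intro: continuous_on_subset)
  then show ?thesis unfolding set_integrable_def by (rule integrable_lebesgue_lborel)
qed

lemma integrable_mult_continuous_compact_support:
  fixes g h :: "'a::euclidean_space \<Rightarrow> real"
  assumes \<Omega>: "\<Omega> \<in> sets lebesgue" and K: "compact K" "K \<subseteq> \<Omega>" and g: "g absolutely_integrable_on K"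
    and h: "continuous_on UNIV h" "\<And>x. x \<notin> K \<Longrightarrow> h x = 0"
  shows "integrable (lebesgue_on \<Omega>) (\<lambda>s. g s * h s)"
proof -
  obtain B where B: "\<And>x. x \<in> K \<Longrightarrow> \<bar>h x\<bar> \<le> B"
    using compact_imp_bounded[OF compact_continuous_image[OF continuous_on_subset[OF h(1)] K(1)]]
    by (auto simp: bounded_iff)
  have [measurable]: "h \<in> borel_measurable lebesgue"
    using h(1) by (intro measurable_completion) (simp add: borel_measurable_continuous_onI)
  have gK: "integrable lebesgue (\<lambda>s. indicator K s * g s)" using g by (simp add: set_integrable_def)
  then have [measurable]: "(\<lambda>s. indicator K s * g s) \<in> borel_measurable lebesgue" by auto
  have "integrable lebesgue (\<lambda>s. (indicator K s * g s) * h s)"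
  proof (rule Bochner_Integration.integrable_bound)
    show "integrable lebesgue (\<lambda>s. B * (indicator K s * g s))" using gK by simp
    have "\<bar>indicator K s * g s * h s\<bar> \<le> \<bar>B * (indicator K s * g s)\<bar>" for s
    proof (cases "s \<in> K")
      case True
      then have "\<bar>h s\<bar> \<le> \<bar>B\<bar>" using B by (meson abs_ge_self order_trans)
      then have "\<bar>g s\<bar> * \<bar>h s\<bar> \<le> \<bar>g s\<bar> * \<bar>B\<bar>" by (rule mult_left_mono) simp
      with True show ?thesis by (simp add: abs_mult mult.commute)
    qed simp
    then show "AE s in lebesgue. norm (indicator K s * g s * h s) \<le> norm (B * (indicator K s * g s))"
      by simp
  qed measurable
  moreover have "(\<lambda>s. (indicator K s * g s) * h s) = (\<lambda>s. indicator \<Omega> s *\<^sub>R (g s * h s))"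
    using h(2) K(2) by (auto simp: fun_eq_iff indicator_def)
  ultimately show ?thesis using \<Omega> by (subst integrable_restrict_space) auto
qed

lemma jacobian_nth: "jacobian u (at s) $ i $ j = frechet_derivative u (at s) (axis j 1) $ i"
  by (simp add: jacobian_def matrix_def)

lemma continuous_jacobian:
  fixes u :: "real^'n \<Rightarrow> real^'n"
  assumes "Ck_on 1 UNIV u"
  shows "continuous_on UNIV (\<lambda>s. jacobian u (at s))"
  using assms unfolding jacobian_def matrix_def
  by (auto intro!: continuous_on_vec_lambda continuous_on_component)

lemma frechet_derivative_nth:
  fixes u :: "real^'n \<Rightarrow> real^'n"
  assumes "u differentiable (at x)"
  shows "frechet_derivative (\<lambda>x. u x $ i) (at x) = (\<lambda>v. frechet_derivative u (at x) v $ i)"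
  by (rule frechet_derivative_bounded_linear[OF bounded_linear_vec_nth assms])

text \<open>Integration by parts. The component of \<open>u\<close> need not have compact support,
  but its product with \<open>\<phi>\<close> does, so the directional derivative of the product
  integrates to 0 and the product rule splits it into the two sides.\<close>

lemma is_weak_gradient_jacobian:
  fixes u :: "real^'n \<Rightarrow> real^'n"
  assumes \<Omega>: "open \<Omega>" and u: "Ck_on 1 UNIV u"
  shows "is_weak_gradient \<Omega> u (\<lambda>s. jacobian u (at s))"
  unfolding is_weak_gradient_def
proof (intro conjI allI impI ballI)
  have cu: "continuous_on UNIV u" using Ck_on_Suc_imp[of 0 UNIV u] u by simp
  note cJ = continuous_jacobian[OF u]
  fix K assume "compact K \<and> K \<subseteq> \<Omega>"
  then show "u absolutely_integrable_on K" "(\<lambda>s. jacobian u (at s)) absolutely_integrable_on K"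
    using cu cJ by (auto intro: continuous_absolutely_integrable_on_compact)
next
  have L: "\<Omega> \<in> sets lebesgue" using \<Omega> by auto
  have cu: "continuous_on UNIV (\<lambda>x. u x $ i)" for i
    using Ck_on_Suc_imp[of 0 UNIV u] u by (auto intro!: continuous_on_component)
  have du: "u differentiable (at x)" for x using u by simp
  have dui: "(\<lambda>x. u x $ i) differentiable (at x)" for x i
    using bounded_linear_imp_differentiable[OF bounded_linear_vec_nth] du
    by (auto intro: differentiable_compose[of "\<lambda>x. x $ i" u])
  have cdu: "continuous_on UNIV (\<lambda>x. frechet_derivative u (at x) v $ i)" for v i
    using u by (auto intro!: continuous_on_component)
  fix \<phi> :: "real^'n \<Rightarrow> real" and i j assume \<phi>: "\<phi> \<in> test_functions \<Omega>"
  obtain K where K: "compact K" "K \<subseteq> \<Omega>" "\<And>x. x \<notin> K \<Longrightarrow> \<phi> x = 0"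
    "\<And>x. x \<notin> K \<Longrightarrow> frechet_derivative \<phi> (at x) = (\<lambda>v. 0)"
    using test_function_support[OF \<phi>] by metis
  let ?e = "axis j 1 :: real^'n"
  let ?f = "\<lambda>s. u s $ i * frechet_derivative \<phi> (at s) ?e"
  let ?g = "\<lambda>s. frechet_derivative u (at s) ?e $ i * \<phi> s"
  have D: "frechet_derivative (\<lambda>x. u x $ i * \<phi> x) (at s) ?e = ?f s + ?g s" for s
    using frechet_derivative_mult[OF dui test_functionD(3)[OF \<phi>]] frechet_derivative_nth[OF du]
    by simp
  have cf: "continuous_on UNIV ?f"
    by (intro continuous_intros cu test_functionD(4)[OF \<phi>])
  have cg: "continuous_on UNIV ?g"
    by (intro continuous_intros cdu test_functionD(2)[OF \<phi>])
  have int: "integrable lebesgue ?f" "integrable lebesgue ?g"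
    using cf cg K by (auto intro!: integrable_lebesgue_lborel integrable_continuous_compact_support[of _ K])
  have "(LINT s|lebesgue. ?f s + ?g s) = 0"
    unfolding D[symmetric]
  proof (rule integral_directional_derivative_eq_0[OF _ _ K(1)])
    show "(\<lambda>x. u x $ i * \<phi> x) differentiable (at x)" for x
      by (intro derivative_intros dui test_functionD(3)[OF \<phi>])
    show "continuous_on UNIV (\<lambda>x. frechet_derivative (\<lambda>x. u x $ i * \<phi> x) (at x) ?e)"
      unfolding D by (intro continuous_on_add cf cg)
  qed (use K in auto)
  then have "(LINT s|lebesgue. ?f s) = - (LINT s|lebesgue. ?g s)" using int by simp
  \<comment> \<open>Both integrands vanish off \<open>\<Omega>\<close>, so integrals over
    \<open>\<Omega>\<close> and over the whole space agree.\<close>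
  moreover have outside: "\<phi> s = 0" "frechet_derivative \<phi> (at s) ?e = 0" if "s \<notin> \<Omega>" for s
  proof -
    have "s \<notin> K" using K(2) that by blast
    then show "\<phi> s = 0" "frechet_derivative \<phi> (at s) ?e = 0" using K(3,4) by simp_all
  qed
  then have "(LINT s|lebesgue_on \<Omega>. ?f s) = (LINT s|lebesgue. ?f s)"
    using L by (subst integral_restrict_space)
      (auto intro!: Bochner_Integration.integral_cong simp: indicator_def)
  moreover have "(LINT s|lebesgue_on \<Omega>. ?g s) = (LINT s|lebesgue. ?g s)"
    using L outside by (subst integral_restrict_space)
      (auto intro!: Bochner_Integration.integral_cong simp: indicator_def)
  ultimately show "(LINT s|lebesgue_on \<Omega>. ?f s) = - (LINT s|lebesgue_on \<Omega>. jacobian u (at s) $ i $ j * \<phi> s)"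
    by (simp add: jacobian_nth)
qed

lemma absolutely_integrable_nth:
  fixes u :: "'a::euclidean_space \<Rightarrow> 'b::euclidean_space^'n"
  assumes "u absolutely_integrable_on K"
  shows "(\<lambda>s. u s $ i) absolutely_integrable_on K"
  using absolutely_integrable_linear[OF assms bounded_linear_vec_nth[of i]] by (simp add: o_def)

text \<open>The integral identity defining a weak gradient does not by itself ensure integrability,
  since non-integrable functions have integral 0 by default. Splitting integrals of sums and
  differences needs it explicitly; local integrability supplies it on the support of
  \<open>\<phi>\<close>.\<close>

lemma is_weak_gradient_integrable:
  fixes u :: "real^'n \<Rightarrow> real^'n"
  assumes "is_weak_gradient \<Omega> u G" "\<Omega> \<in> sets lebesgue" and \<phi>: "\<phi> \<in> test_functions \<Omega>"
  shows "integrable (lebesgue_on \<Omega>) (\<lambda>s. u s $ i * frechet_derivative \<phi> (at s) v)"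
    and "integrable (lebesgue_on \<Omega>) (\<lambda>s. G s $ i $ j * \<phi> s)"
proof -
  obtain K where K: "compact K" "K \<subseteq> \<Omega>" "\<And>x. x \<notin> K \<Longrightarrow> \<phi> x = 0"
    "\<And>x. x \<notin> K \<Longrightarrow> frechet_derivative \<phi> (at x) = (\<lambda>v. 0)"
    using test_function_support[OF \<phi>] by metis
  have "u absolutely_integrable_on K" "G absolutely_integrable_on K"
    using assms K by (auto simp: is_weak_gradient_def)
  then show "integrable (lebesgue_on \<Omega>) (\<lambda>s. u s $ i * frechet_derivative \<phi> (at s) v)"
    "integrable (lebesgue_on \<Omega>) (\<lambda>s. G s $ i $ j * \<phi> s)"
    using K assms by (auto intro!: integrable_mult_continuous_compact_support[of _ K]
        absolutely_integrable_nth test_functionD[OF \<phi>])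
qed

lemma is_weak_gradient_diff:
  fixes u v :: "real^'n \<Rightarrow> real^'n"
  assumes \<Omega>: "\<Omega> \<in> sets lebesgue" and u: "is_weak_gradient \<Omega> u G" and v: "is_weak_gradient \<Omega> v H"
  shows "is_weak_gradient \<Omega> (u - v) (\<lambda>s. G s - H s)"
  unfolding is_weak_gradient_def
proof (intro conjI allI impI ballI)
  fix K assume "compact K \<and> K \<subseteq> \<Omega>"
  then show "(u - v) absolutely_integrable_on K" "(\<lambda>s. G s - H s) absolutely_integrable_on K"
    using u v by (auto simp: is_weak_gradient_def fun_diff_def intro!: set_integral_diff)
next
  fix \<phi> :: "real^'n \<Rightarrow> real" and i j assume \<phi>: "\<phi> \<in> test_functions \<Omega>"
  note I = is_weak_gradient_integrable[OF u \<Omega> \<phi>] is_weak_gradient_integrable[OF v \<Omega> \<phi>]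
  have "(LINT s|lebesgue_on \<Omega>. u s $ i * frechet_derivative \<phi> (at s) (axis j 1)) = - (LINT s|lebesgue_on \<Omega>. G s $ i $ j * \<phi> s)"
    "(LINT s|lebesgue_on \<Omega>. v s $ i * frechet_derivative \<phi> (at s) (axis j 1)) = - (LINT s|lebesgue_on \<Omega>. H s $ i $ j * \<phi> s)"
    using u v \<phi> by (auto simp: is_weak_gradient_def)
  then show "(LINT s|lebesgue_on \<Omega>. (u - v) s $ i * frechet_derivative \<phi> (at s) (axis j 1))
      = - (LINT s|lebesgue_on \<Omega>. (G s - H s) $ i $ j * \<phi> s)"
    using I by (simp add: left_diff_distrib)
qed

text \<open>Each entry of the difference is locally integrable and orthogonal to all test functions,
  so the fundamental lemma applies entry by entry.\<close>

lemma is_weak_gradient_unique: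
  fixes u :: "real^'n \<Rightarrow> real^'n"
  assumes \<Omega>: "open \<Omega>" and G: "is_weak_gradient \<Omega> u G" and H: "is_weak_gradient \<Omega> u H"
  shows "AE s in lebesgue_on \<Omega>. G s = H s"
proof -
  have L: "\<Omega> \<in> sets lebesgue" using \<Omega> by auto
  have "AE s in lebesgue_on \<Omega>. G s $ i $ j - H s $ i $ j = 0" for i j
  proof (rule AE_eq_0_if_test_integrals_eq_0[OF \<Omega>])
    fix K assume "compact K" "K \<subseteq> \<Omega>"
    then have "G absolutely_integrable_on K" "H absolutely_integrable_on K"
      using G H by (auto simp: is_weak_gradient_def)
    then show "(\<lambda>s. G s $ i $ j - H s $ i $ j) absolutely_integrable_on K"
      by (intro set_integral_diff absolutely_integrable_nth)
  next
    fix \<phi> :: "real^'n \<Rightarrow> real" assume \<phi>: "\<phi> \<in> test_functions \<Omega>"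
    have "(LINT s|lebesgue_on \<Omega>. G s $ i $ j * \<phi> s) = (LINT s|lebesgue_on \<Omega>. H s $ i $ j * \<phi> s)"
      using G H \<phi> by (auto simp: is_weak_gradient_def)
    then show "(LINT s|lebesgue_on \<Omega>. (G s $ i $ j - H s $ i $ j) * \<phi> s) = 0"
      using is_weak_gradient_integrable(2)[OF G L \<phi>] is_weak_gradient_integrable(2)[OF H L \<phi>]
      by (simp add: left_diff_distrib)
  qed
  then have "AE s in lebesgue_on \<Omega>. \<forall>i j. G s $ i $ j - H s $ i $ j = 0"
    by (simp add: AE_finite_all[of UNIV, simplified])
  then show ?thesis by eventually_elim (simp add: vec_eq_iff)
qed

subsection \<open>Solenoidal Sobolev spaces\<close>

lemma continuous_compact_support_in_Lp:
  fixes f :: "'a::euclidean_space \<Rightarrow> 'b::euclidean_space"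
  assumes \<Omega>: "\<Omega> \<in> sets lebesgue" and p: "p > 0"
    and f: "continuous_on UNIV f" "compact K" "\<And>x. x \<notin> K \<Longrightarrow> f x = 0"
  shows "f \<in> Lp_space \<Omega> p"
proof -
  have "continuous_on UNIV (\<lambda>s. norm (f s) powr p)"
    using f(1) p by (intro continuous_on_powr' continuous_intros) auto
  then have "integrable lebesgue (\<lambda>s. norm (f s) powr p)"
    using f by (intro integrable_lebesgue_lborel integrable_continuous_compact_support[of _ K]) auto
  then have "integrable lebesgue (\<lambda>s. indicator \<Omega> s *\<^sub>R (norm (f s) powr p))"
    using \<Omega> by (intro integrable_mult_indicator) auto
  moreover have "f \<in> borel_measurable lebesgue"
    using f(1) by (intro measurable_completion) (simp add: borel_measurable_continuous_onI)
  ultimately show ?thesis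
    unfolding Lp_space_def using \<Omega>
    by (auto simp: integrable_restrict_space intro: measurable_restrict_space1)
qed

text \<open>This makes the choice behind \<open>weak_gradient\<close> harmless: every weak gradient
  found by a construction may replace it under an integral.\<close>

lemma weak_gradient_AE:
  assumes "open \<Omega>" "is_weak_gradient \<Omega> u G"
  shows "is_weak_gradient \<Omega> u (weak_gradient \<Omega> u)"
    and "AE s in lebesgue_on \<Omega>. weak_gradient \<Omega> u s = G s"
proof -
  show *: "is_weak_gradient \<Omega> u (weak_gradient \<Omega> u)"
    unfolding weak_gradient_def using someI[of "is_weak_gradient \<Omega> u", OF assms(2)] .
  show "AE s in lebesgue_on \<Omega>. weak_gradient \<Omega> u s = G s"
    by (rule is_weak_gradient_unique[OF assms(1) * assms(2)])
qed

lemma W1p_spaceD: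
  assumes \<Omega>: "open \<Omega>" and u: "u \<in> W1p_space \<Omega> p"
  shows "u \<in> Lp_space \<Omega> p" "is_weak_gradient \<Omega> u (weak_gradient \<Omega> u)"
    "weak_gradient \<Omega> u \<in> Lp_space \<Omega> p"
proof -
  obtain G where G: "G \<in> Lp_space \<Omega> p" "is_weak_gradient \<Omega> u G"
    using u by (auto simp: W1p_space_def)
  show "u \<in> Lp_space \<Omega> p" using u by (auto simp: W1p_space_def)
  show "is_weak_gradient \<Omega> u (weak_gradient \<Omega> u)" by (rule weak_gradient_AE[OF \<Omega> G(2)])
  have "AE s in lebesgue_on \<Omega>. G s = weak_gradient \<Omega> u s"
    using weak_gradient_AE(2)[OF \<Omega> G(2)] by eventually_elim simp
  then show "weak_gradient \<Omega> u \<in> Lp_space \<Omega> p"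
    using \<Omega> by (intro Lp_space_AE[OF _ G(1)]) auto
qed

lemma W1p_space_diff:
  assumes \<Omega>: "open \<Omega>" and p: "p \<ge> 0" and u: "u \<in> W1p_space \<Omega> p" and v: "v \<in> W1p_space \<Omega> p"
  shows "u - v \<in> W1p_space \<Omega> p"
    and "AE s in lebesgue_on \<Omega>. weak_gradient \<Omega> (u - v) s = weak_gradient \<Omega> u s - weak_gradient \<Omega> v s"
proof -
  note U = W1p_spaceD[OF \<Omega> u] and V = W1p_spaceD[OF \<Omega> v]
  have G: "is_weak_gradient \<Omega> (u - v) (\<lambda>s. weak_gradient \<Omega> u s - weak_gradient \<Omega> v s)"
    using \<Omega> by (intro is_weak_gradient_diff U V) auto
  show "AE s in lebesgue_on \<Omega>. weak_gradient \<Omega> (u - v) s = weak_gradient \<Omega> u s - weak_gradient \<Omega> v s"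
    by (rule weak_gradient_AE[OF \<Omega> G])
  show "u - v \<in> W1p_space \<Omega> p"
    unfolding W1p_space_def mem_Collect_eq
    using G Lp_space_diff(1)[OF U(1) V(1) p] Lp_space_diff(1)[OF U(3) V(3) p]
    by (auto simp: fun_diff_def)
qed

lemma W1p_norm_powr:
  assumes "p > 0"
  shows "W1p_norm \<Omega> p u powr p = (LINT s|lebesgue_on \<Omega>. norm (u s) powr p)
    + (LINT s|lebesgue_on \<Omega>. norm (weak_gradient \<Omega> u s) powr p)"
  using assms by (simp add: W1p_norm_def powr_powr Lp_norm_powr)

lemma W1p_norm_nonneg: "W1p_norm \<Omega> p u \<ge> 0"
  by (simp add: W1p_norm_def)

lemma norms_le_W1p_norm:
  assumes p: "p > 0"
  shows "Lp_norm \<Omega> p u \<le> W1p_norm \<Omega> p u" "Vp_norm \<Omega> p u \<le> W1p_norm \<Omega> p u"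
proof -
  have "(Lp_norm \<Omega> p u powr p) powr (1 / p) \<le> W1p_norm \<Omega> p u"
    "(Vp_norm \<Omega> p u powr p) powr (1 / p) \<le> W1p_norm \<Omega> p u"
    unfolding W1p_norm_def Vp_norm_def using p by (intro powr_mono2; simp)+
  then show "Lp_norm \<Omega> p u \<le> W1p_norm \<Omega> p u" "Vp_norm \<Omega> p u \<le> W1p_norm \<Omega> p u"
    using p by (auto simp: powr_powr Lp_norm_nonneg Vp_norm_def)
qed

lemma W1p_norm_diff_powr_le:
  assumes \<Omega>: "open \<Omega>" and p: "p > 0" and u: "u \<in> W1p_space \<Omega> p" and v: "v \<in> W1p_space \<Omega> p"
  shows "W1p_norm \<Omega> p (u - v) powr p \<le> 2 powr p * (W1p_norm \<Omega> p u powr p + W1p_norm \<Omega> p v powr p)"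
proof -
  note U = W1p_spaceD[OF \<Omega> u] and V = W1p_spaceD[OF \<Omega> v]
  have p0: "p \<ge> 0" using p by simp
  have "Lp_norm \<Omega> p (weak_gradient \<Omega> (u - v)) = Lp_norm \<Omega> p (\<lambda>s. weak_gradient \<Omega> u s - weak_gradient \<Omega> v s)"
    using \<Omega> W1p_space_diff[OF \<Omega> p0 u v]
    by (intro Lp_norm_AE Lp_spaceD[OF W1p_spaceD(3)[of _ _ p]]) auto
  then have "(LINT s|lebesgue_on \<Omega>. norm (weak_gradient \<Omega> (u - v) s) powr p)
      = (LINT s|lebesgue_on \<Omega>. norm (weak_gradient \<Omega> u s - weak_gradient \<Omega> v s) powr p)"
    by (simp add: Lp_norm_powr[OF p, symmetric])
  then show ?thesis
    using Lp_space_diff(2)[OF U(1) V(1) p0] Lp_space_diff(2)[OF U(3) V(3) p0]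
    unfolding W1p_norm_powr[OF p] minus_apply distrib_left by linarith
qed

text \<open>With \<open>e / 8\<close> the quasi-triangle inequality gives at most 2^p * 2 * (e/8)^p
  = 2 * (e/4)^p. As p \<ge> 1, the leading 2 is at most 2^p, which leaves (e/2)^p < e^p; hence 8
  works for all such p.\<close>

lemma W1p_norm_diff_less:
  assumes \<Omega>: "open \<Omega>" and p: "p \<ge> 1" and u: "u \<in> W1p_space \<Omega> p" and v: "v \<in> W1p_space \<Omega> p"
    and "W1p_norm \<Omega> p u < e / 8" "W1p_norm \<Omega> p v < e / 8"
  shows "W1p_norm \<Omega> p (u - v) < e"
proof -
  have e: "e > 0" using assms(5) W1p_norm_nonneg[of \<Omega> p u] by linarith
  have "W1p_norm \<Omega> p u powr p \<le> (e / 8) powr p" "W1p_norm \<Omega> p v powr p \<le> (e / 8) powr p"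
    using assms by (auto intro!: powr_mono2 W1p_norm_nonneg)
  moreover have "2 powr p * (W1p_norm \<Omega> p u powr p + W1p_norm \<Omega> p v powr p)
      \<le> 2 powr p * ((e / 8) powr p + (e / 8) powr p)"
    using calculation by (intro mult_left_mono add_mono) auto
  moreover have "2 powr p * ((e / 8) powr p + (e / 8) powr p) = 2 * (e / 4) powr p"
    using e by (simp add: powr_divide powr_mult[symmetric] flip: powr_mult)
       (simp add: field_simps flip: powr_mult)
  moreover have "2 * (e / 4) powr p \<le> (2 * (e / 4)) powr p"
  proof -
    have "(2::real) powr 1 \<le> 2 powr p" using p by (intro powr_mono) auto
    then have "2 * (e / 4) powr p \<le> 2 powr p * (e / 4) powr p" by (intro mult_right_mono) auto
    also have "\<dots> = (2 * (e / 4)) powr p" using e by (subst powr_mult) auto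
    finally show ?thesis .
  qed
  moreover have "(2 * (e / 4)) powr p < e powr p" using e p by (intro powr_less_mono2) auto
  moreover have "W1p_norm \<Omega> p (u - v) powr p \<le> 2 powr p * (W1p_norm \<Omega> p u powr p + W1p_norm \<Omega> p v powr p)"
    using p by (intro W1p_norm_diff_powr_le[OF \<Omega> _ u v]) auto
  ultimately have "W1p_norm \<Omega> p (u - v) powr p < e powr p" by linarith
  then show ?thesis using e p powr_mono2[of p e "W1p_norm \<Omega> p (u - v)"] by (force simp: not_less[symmetric])
qed

section \<open>Test functions and their closures under differences\<close>

lemma Ck_diff:
  assumes "Ck_on k UNIV f" "Ck_on k UNIV g"
  shows "Ck_on k UNIV (\<lambda>x. f x - g x)"
  using Ck_add[OF assms(1) Ck_on_bounded_linear[OF bounded_linear_minus[OF bounded_linear_ident] assms(2)]]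
  by simp

lemma test_functions_diff:
  assumes "u \<in> test_functions \<Omega>" "v \<in> test_functions \<Omega>"
  shows "u - v \<in> test_functions \<Omega>"
proof -
  have sub: "closure {x. (u - v) x \<noteq> 0} \<subseteq> closure {x. u x \<noteq> 0} \<union> closure {x. v x \<noteq> 0}"
    unfolding closure_Un[symmetric] by (rule closure_mono) auto
  have "compact (closure {x. u x \<noteq> 0} \<union> closure {x. v x \<noteq> 0})"
    using assms by (auto simp: test_functions_def intro: compact_Un)
  then have "compact (closure {x. (u - v) x \<noteq> 0})"
    using sub closed_closure compact_Int_closed[of _ "closure {x. (u - v) x \<noteq> 0}"]
    by (metis inf.absorb_iff2)
  moreover have "closure {x. (u - v) x \<noteq> 0} \<subseteq> \<Omega>"
    using sub assms by (auto simp: test_functions_def)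
  moreover have "Ck_on k UNIV (u - v)" for k
    using Ck_diff[of k u v] assms by (simp add: test_functions_def fun_diff_def)
  ultimately show ?thesis by (simp add: test_functions_def)
qed

lemma solenoidal_tests_diff:
  assumes u: "u \<in> solenoidal_tests \<Omega>" and v: "v \<in> solenoidal_tests \<Omega>"
  shows "u - v \<in> solenoidal_tests \<Omega>"
proof -
  have T: "u \<in> test_functions \<Omega>" "v \<in> test_functions \<Omega>"
    using u v by (auto simp: solenoidal_tests_def)
  have "trace (jacobian (u - v) (at x)) = trace (jacobian u (at x)) - trace (jacobian v (at x))" for x
  proof -
    have "(u has_derivative frechet_derivative u (at x)) (at x)"
      "(v has_derivative frechet_derivative v (at x)) (at x)"
      using T test_functionD(3) by (auto simp flip: frechet_derivative_works)
    from frechet_derivative_at[OF has_derivative_diff[OF this], symmetric]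
    have "frechet_derivative (u - v) (at x) = (\<lambda>h. frechet_derivative u (at x) h - frechet_derivative v (at x) h)"
      by (simp add: fun_diff_def)
    then show ?thesis by (simp add: trace_def jacobian_nth sum_subtractf)
  qed
  then show ?thesis
    using u v test_functions_diff[OF T] by (auto simp: solenoidal_tests_def)
qed

lemma test_function_in_W1p:
  assumes \<Omega>: "open \<Omega>" and p: "p > 0" and u: "u \<in> test_functions \<Omega>"
  shows "u \<in> W1p_space \<Omega> p"
    and "AE s in lebesgue_on \<Omega>. weak_gradient \<Omega> u s = jacobian u (at s)"
proof -
  have L: "\<Omega> \<in> sets lebesgue" using \<Omega> by auto
  obtain K where K: "compact K" "K \<subseteq> \<Omega>" "\<And>x. x \<notin> K \<Longrightarrow> u x = 0"
    "\<And>x. x \<notin> K \<Longrightarrow> frechet_derivative u (at x) = (\<lambda>v. 0)"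
    using test_function_support[OF u] by metis
  have C: "Ck_on 1 UNIV u" by (rule test_functionD[OF u])
  have G: "is_weak_gradient \<Omega> u (\<lambda>s. jacobian u (at s))"
    by (rule is_weak_gradient_jacobian[OF \<Omega> C])
  have "jacobian u (at x) = 0" if "x \<notin> K" for x
    using K(4)[OF that] by (simp add: vec_eq_iff jacobian_nth)
  then have "(\<lambda>s. jacobian u (at s)) \<in> Lp_space \<Omega> p"
    by (intro continuous_compact_support_in_Lp[OF L p continuous_jacobian[OF C] K(1)])
  moreover have "u \<in> Lp_space \<Omega> p"
    by (intro continuous_compact_support_in_Lp[OF L p test_functionD(2)[OF u] K(1)] K(3))
  ultimately show "u \<in> W1p_space \<Omega> p" using G by (auto simp: W1p_space_def)
  show "AE s in lebesgue_on \<Omega>. weak_gradient \<Omega> u s = jacobian u (at s)"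
    by (rule weak_gradient_AE[OF \<Omega> G])
qed

text \<open>The constant $8$ absorbs the quasi-triangle inequality of \<open>W1p_norm\<close>.\<close>

lemma norm_closure_diff:
  fixes N :: "('a \<Rightarrow> 'b::ab_group_add) \<Rightarrow> real"
  assumes X: "\<And>u v. u \<in> X \<Longrightarrow> v \<in> X \<Longrightarrow> u - v \<in> X"
    and S: "\<And>u v. u \<in> S \<Longrightarrow> v \<in> S \<Longrightarrow> u - v \<in> S" and SX: "S \<subseteq> X"
    and N: "\<And>u v e. u \<in> X \<Longrightarrow> v \<in> X \<Longrightarrow> N u < e / 8 \<Longrightarrow> N v < e / 8 \<Longrightarrow> N (u - v) < e"
    and u: "u \<in> norm_closure N X S" and v: "v \<in> norm_closure N X S"
  shows "u - v \<in> norm_closure N X S"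
  unfolding norm_closure_def mem_Collect_eq
proof (intro conjI allI impI)
  show "u - v \<in> X" using u v X by (auto simp: norm_closure_def)
  fix e :: real assume "e > 0"
  then obtain \<phi> \<psi> where *: "\<phi> \<in> S" "\<psi> \<in> S" "N (u - \<phi>) < e / 8" "N (v - \<psi>) < e / 8"
    using u v by (fastforce simp: norm_closure_def dest!: spec[of _ "e / 8"])
  have "N ((u - \<phi>) - (v - \<psi>)) < e"
    by (rule N) (use * u v SX in \<open>auto simp: norm_closure_def intro!: X\<close>)
  moreover have "(u - \<phi>) - (v - \<psi>) = (u - v) - (\<phi> - \<psi>)" by (auto simp: fun_eq_iff)
  ultimately show "\<exists>\<phi>\<in>S. N (u - v - \<phi>) < e" using *(1,2) S by auto
qed

text \<open>Even for the zero function the chosen gradient is 0 only almost everywhere. The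
  statement lets a test function serve as its own approximation in
  \<open>norm_closure\<close>.\<close>

lemma W1p_norm_diff_self:
  assumes \<Omega>: "open \<Omega>" and p: "p > 0" and u: "u \<in> W1p_space \<Omega> p"
  shows "W1p_norm \<Omega> p (u - u) = 0"
proof -
  have "AE s in lebesgue_on \<Omega>. norm (weak_gradient \<Omega> (u - u) s) powr p = 0"
    using W1p_space_diff(2)[OF \<Omega> _ u u] p by (auto elim!: eventually_mono)
  then have "(LINT s|lebesgue_on \<Omega>. norm (weak_gradient \<Omega> (u - u) s) powr p) = 0"
    by (rule integral_eq_zero_AE)
  then have "W1p_norm \<Omega> p (u - u) powr p = 0" using p by (simp add: W1p_norm_powr)
  then show ?thesis using p by simp
qed

lemma subset_norm_closure:
  assumes "S \<subseteq> X" "\<And>u. u \<in> S \<Longrightarrow> N (u - u) = 0"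
  shows "S \<subseteq> norm_closure N X S"
  using assms by (auto simp: norm_closure_def) (metis)

lemma W01p_space_diff:
  assumes \<Omega>: "open \<Omega>" and p: "p \<ge> 1" and u: "u \<in> W01p_space \<Omega> p" and v: "v \<in> W01p_space \<Omega> p"
  shows "u - v \<in> W01p_space \<Omega> p"
  using u v unfolding W01p_space_def
  by (rule norm_closure_diff[rotated -2])
     (use \<Omega> p in \<open>auto intro: W1p_space_diff test_functions_diff test_function_in_W1p W1p_norm_diff_less\<close>)

lemma Vp_spaceD:
  assumes "u \<in> Vp_space \<Omega> p"
  shows "u \<in> W01p_space \<Omega> p" "u \<in> W1p_space \<Omega> p"
  using assms by (auto simp: Vp_space_def W01p_space_def norm_closure_def)

lemma solenoidal_tests_subset_W01p:
  assumes \<Omega>: "open \<Omega>" and p: "p > 0"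
  shows "solenoidal_tests \<Omega> \<subseteq> W01p_space \<Omega> p"
proof -
  have "test_functions \<Omega> \<subseteq> W01p_space \<Omega> p"
    unfolding W01p_space_def using \<Omega> p
    by (intro subset_norm_closure) (auto intro: test_function_in_W1p W1p_norm_diff_self)
  then show ?thesis by (auto simp: solenoidal_tests_def)
qed

text \<open>Places the approximating test functions in \<open>Vp_space\<close>, so that the
  approximation errors lie there too and the embedding and Gagliardo-Nirenberg inequalities can be
  applied to them.\<close>

lemma solenoidal_tests_subset_Vp:
  assumes \<Omega>: "open \<Omega>" and p: "p > 0"
  shows "solenoidal_tests \<Omega> \<subseteq> Vp_space \<Omega> p"
  unfolding Vp_space_def using \<Omega> p
  by (intro subset_norm_closure solenoidal_tests_subset_W01p W1p_norm_diff_self)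
     (auto intro: test_function_in_W1p simp: solenoidal_tests_def)

lemma Vp_space_diff:
  assumes \<Omega>: "open \<Omega>" and p: "p \<ge> 1" and u: "u \<in> Vp_space \<Omega> p" and v: "v \<in> Vp_space \<Omega> p"
  shows "u - v \<in> Vp_space \<Omega> p"
  using u v unfolding Vp_space_def
proof (rule norm_closure_diff[rotated -2])
  show "solenoidal_tests \<Omega> \<subseteq> W01p_space \<Omega> p"
    using \<Omega> p by (intro solenoidal_tests_subset_W01p) auto
  show "W1p_norm \<Omega> p (u - v) < e" if "u \<in> W01p_space \<Omega> p" "v \<in> W01p_space \<Omega> p"
    "W1p_norm \<Omega> p u < e / 8" "W1p_norm \<Omega> p v < e / 8" for u v e
    using that \<Omega> p by (intro W1p_norm_diff_less) (auto simp: W01p_space_def norm_closure_def)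
qed (use \<Omega> p in \<open>auto intro: W01p_space_diff solenoidal_tests_diff\<close>)

lemma Vp_space_approximation:
  assumes "u \<in> Vp_space \<Omega> p"
  obtains \<zeta> where "\<And>n. \<zeta> n \<in> solenoidal_tests \<Omega>" "(\<lambda>n. W1p_norm \<Omega> p (u - \<zeta> n)) \<longlonglongrightarrow> 0"
proof -
  have "\<forall>n. \<exists>\<phi>\<in>solenoidal_tests \<Omega>. W1p_norm \<Omega> p (u - \<phi>) < inverse (real (Suc n))"
    using assms unfolding Vp_space_def norm_closure_def by auto
  then obtain \<zeta> where \<zeta>: "\<And>n. \<zeta> n \<in> solenoidal_tests \<Omega>"
    "\<And>n. W1p_norm \<Omega> p (u - \<zeta> n) < inverse (real (Suc n))" by metis
  have "(\<lambda>n. W1p_norm \<Omega> p (u - \<zeta> n)) \<longlonglongrightarrow> 0"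
    by (rule tendsto_sandwich[OF _ _ tendsto_const LIMSEQ_inverse_real_of_nat])
       (use \<zeta>(2) in \<open>auto intro!: always_eventually W1p_norm_nonneg less_imp_le simp del: of_nat_Suc\<close>)
  with \<zeta>(1) show thesis by (rule that)
qed

subsection \<open>The convective term\<close>

text \<open>Cauchy-Schwarz in each row; the matrix norm is the Frobenius norm, that is, the
  Euclidean norm of the row norms. The constant 1 adds no factor to
  \<open>eta_tilde\<close>.\<close>

lemma norm_matrix_vector_mult_le:
  fixes A :: "real^'n^'m"
  shows "norm (A *v x) \<le> norm A * norm x"
proof -
  have "norm (A *v x) = L2_set (\<lambda>i. \<bar>A $ i \<bullet> x\<bar>) UNIV"
    by (simp add: norm_vec_def matrix_vector_mul_component)
  also have "\<dots> \<le> L2_set (\<lambda>i. norm x * norm (A $ i)) UNIV"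
    using Cauchy_Schwarz_ineq2[of "A $ _" x] by (intro L2_set_mono) (auto simp: mult.commute)
  also have "\<dots> = norm x * norm A"
    by (simp add: L2_set_right_distrib norm_vec_def)
  finally show ?thesis by (simp add: mult.commute)
qed

lemma borel_measurable_nth [measurable (raw)]:
  fixes f :: "'a \<Rightarrow> 'b::real_normed_vector^'n"
  shows "f \<in> borel_measurable M \<Longrightarrow> (\<lambda>s. f s $ i) \<in> borel_measurable M"
  by (rule borel_measurable_continuous_on[of "\<lambda>v. v $ i"]) (auto intro: continuous_intros)

lemma borel_measurable_matrix_vector_inner:
  fixes G :: "'a \<Rightarrow> real^'n^'n"
  assumes [measurable]: "G \<in> borel_measurable M" "u \<in> borel_measurable M" "v \<in> borel_measurable M"
  shows "(\<lambda>s. (G s *v u s) \<bullet> v s) \<in> borel_measurable M"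
  unfolding inner_vec_def matrix_vector_mult_def by simp

text \<open>The exponents match because 1/p + 2 * (p-1)/(2p) = 1. The bound gives both the
  continuity used in the limit for the convective term and the final estimate by the gradient of
  \<open>y\<close>.\<close>

lemma trilinear_Lp:
  fixes G :: "real^'n \<Rightarrow> real^'n^'n"
  assumes p: "p > 1" and G: "G \<in> Lp_space \<Omega> p"
    and u: "u \<in> Lp_space \<Omega> (2 * p / (p - 1))" and v: "v \<in> Lp_space \<Omega> (2 * p / (p - 1))"
  shows "integrable (lebesgue_on \<Omega>) (\<lambda>s. (G s *v u s) \<bullet> v s)"
    and "\<bar>LINT s|lebesgue_on \<Omega>. (G s *v u s) \<bullet> v s\<bar>
      \<le> Lp_norm \<Omega> p G * (Lp_norm \<Omega> (2 * p / (p - 1)) u * Lp_norm \<Omega> (2 * p / (p - 1)) v)"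
proof -
  note H = Holder_Lp_triple[OF p G u v]
  have b: "\<bar>(G s *v u s) \<bullet> v s\<bar> \<le> norm (G s) * (norm (u s) * norm (v s))" for s
  proof -
    have "\<bar>(G s *v u s) \<bullet> v s\<bar> \<le> norm (G s *v u s) * norm (v s)" by (rule Cauchy_Schwarz_ineq2)
    also have "\<dots> \<le> (norm (G s) * norm (u s)) * norm (v s)"
      by (intro mult_right_mono norm_matrix_vector_mult_le) simp
    finally show ?thesis by (simp add: mult.assoc)
  qed
  have m: "(\<lambda>s. (G s *v u s) \<bullet> v s) \<in> borel_measurable (lebesgue_on \<Omega>)"
    by (intro borel_measurable_matrix_vector_inner Lp_spaceD(1)[OF G] Lp_spaceD(1)[OF u] Lp_spaceD(1)[OF v])
  show I: "integrable (lebesgue_on \<Omega>) (\<lambda>s. (G s *v u s) \<bullet> v s)"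
    by (rule Bochner_Integration.integrable_bound[OF H(1) m]) (use b in \<open>auto intro!: AE_I2 order_trans[OF b]\<close>)
  have "\<bar>LINT s|lebesgue_on \<Omega>. (G s *v u s) \<bullet> v s\<bar> \<le> (LINT s|lebesgue_on \<Omega>. \<bar>(G s *v u s) \<bullet> v s\<bar>)"
    by (rule integral_abs_bound)
  also have "\<dots> \<le> (LINT s|lebesgue_on \<Omega>. norm (G s) * (norm (u s) * norm (v s)))"
    using b I H(1) by (intro integral_mono) auto
  also note H(2)
  finally show "\<bar>LINT s|lebesgue_on \<Omega>. (G s *v u s) \<bullet> v s\<bar>
      \<le> Lp_norm \<Omega> p G * (Lp_norm \<Omega> (2 * p / (p - 1)) u * Lp_norm \<Omega> (2 * p / (p - 1)) v)" .
qed

section \<open>Weak divergence-freeness and cancellation of the convective term\<close>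

lemma linear_eq_sum_axis:
  fixes f :: "real^'n \<Rightarrow> real"
  assumes "linear f"
  shows "f w = (\<Sum>i\<in>UNIV. w $ i * f (axis i 1))"
  by (subst basis_expansion[symmetric])
     (simp add: linear_sum[OF assms] linear_cmul[OF assms] scalar_mult_eq_scaleR)

text \<open>The diagonal cases i = j of the weak gradient identity, summed over i, produce the trace
  of the Jacobian, which vanishes.\<close>

lemma solenoidal_weakly_divergence_free:
  fixes x :: "real^'n \<Rightarrow> real^'n" and \<phi> :: "real^'n \<Rightarrow> real"
  assumes \<Omega>: "open \<Omega>" and x: "x \<in> solenoidal_tests \<Omega>" and \<phi>: "\<phi> \<in> test_functions \<Omega>"
  shows "(LINT s|lebesgue_on \<Omega>. frechet_derivative \<phi> (at s) (x s)) = 0"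
proof -
  have L: "\<Omega> \<in> sets lebesgue" using \<Omega> by auto
  have x': "x \<in> test_functions \<Omega>" using x by (auto simp: solenoidal_tests_def)
  have J: "is_weak_gradient \<Omega> x (\<lambda>s. jacobian x (at s))"
    by (rule is_weak_gradient_jacobian[OF \<Omega> test_functionD(1)[OF x']])
  note I = is_weak_gradient_integrable[OF J L \<phi>]
  have lin: "linear (frechet_derivative \<phi> (at s))" for s
    by (rule linear_frechet_derivative[OF test_functionD(3)[OF \<phi>]])
  have "(LINT s|lebesgue_on \<Omega>. frechet_derivative \<phi> (at s) (x s))
      = (LINT s|lebesgue_on \<Omega>. (\<Sum>i\<in>UNIV. x s $ i * frechet_derivative \<phi> (at s) (axis i 1)))"
    by (subst linear_eq_sum_axis[OF lin]) simp
  also have "\<dots> = (\<Sum>i\<in>UNIV. (LINT s|lebesgue_on \<Omega>. x s $ i * frechet_derivative \<phi> (at s) (axis i 1)))"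
    by (intro Bochner_Integration.integral_sum I)
  also have "\<dots> = (\<Sum>i\<in>UNIV. - (LINT s|lebesgue_on \<Omega>. jacobian x (at s) $ i $ i * \<phi> s))"
    using J \<phi> by (auto simp: is_weak_gradient_def)
  also have "\<dots> = - (LINT s|lebesgue_on \<Omega>. (\<Sum>i\<in>UNIV. jacobian x (at s) $ i $ i * \<phi> s))"
    using I by (subst Bochner_Integration.integral_sum) (auto simp: sum_negf)
  also have "\<dots> = - (LINT s|lebesgue_on \<Omega>. trace (jacobian x (at s)) * \<phi> s)"
    by (simp add: trace_def sum_distrib_right)
  also have "\<dots> = 0" using x by (simp add: solenoidal_tests_def)
  finally show ?thesis .
qed

text \<open>For fixed \<open>\<phi>\<close> the left-hand side is a continuous linear functional of
  \<open>x\<close> in the p-th Lebesgue space, since the derivative of \<open>\<phi>\<close> is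
  continuous with compact support. It vanishes on solenoidal test functions, which approximate
  \<open>x\<close>.\<close>

lemma Vp_weakly_divergence_free:
  fixes x :: "real^'n \<Rightarrow> real^'n" and \<phi> :: "real^'n \<Rightarrow> real"
  assumes \<Omega>: "open \<Omega>" and p: "p > 1" and x: "x \<in> Vp_space \<Omega> p" and \<phi>: "\<phi> \<in> test_functions \<Omega>"
  shows "(LINT s|lebesgue_on \<Omega>. frechet_derivative \<phi> (at s) (x s)) = 0"
proof -
  have L: "\<Omega> \<in> sets lebesgue" using \<Omega> by auto
  define q where "q = p / (p - 1)"
  have q: "q > 1" "1 / q + 1 / p = 1" using p by (auto simp: q_def field_simps)
  obtain K where K: "compact K" "K \<subseteq> \<Omega>" "\<And>x. x \<notin> K \<Longrightarrow> \<phi> x = 0"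
    "\<And>x. x \<notin> K \<Longrightarrow> frechet_derivative \<phi> (at x) = (\<lambda>v. 0)"
    using test_function_support[OF \<phi>] by metis
  have lin: "linear (frechet_derivative \<phi> (at s))" for s
    by (rule linear_frechet_derivative[OF test_functionD(3)[OF \<phi>]])
  \<comment> \<open>The sum of the absolute partial derivatives dominates the operator norm of the
    derivative; its continuity and compact support are immediate, so it lies in the conjugate
    Lebesgue space.\<close>
  define h where "h s = (\<Sum>i\<in>UNIV. \<bar>frechet_derivative \<phi> (at s) (axis i 1)\<bar>)" for s
  have h: "h \<in> Lp_space \<Omega> q"
  proof (rule continuous_compact_support_in_Lp[OF L _ _ K(1)])
    show "continuous_on UNIV h" unfolding h_def
      by (intro continuous_intros test_functionD(4)[OF \<phi>])
    show "h s = 0" if "s \<notin> K" for s using K(4)[OF that] by (simp add: h_def)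
  qed (use q in auto)
  have bound: "\<bar>frechet_derivative \<phi> (at s) w\<bar> \<le> norm (h s) * norm w" for s w
  proof -
    have "\<bar>frechet_derivative \<phi> (at s) w\<bar> \<le> (\<Sum>i\<in>UNIV. \<bar>w $ i * frechet_derivative \<phi> (at s) (axis i 1)\<bar>)"
      by (subst linear_eq_sum_axis[OF lin]) (rule sum_abs)
    also have "\<dots> \<le> (\<Sum>i\<in>UNIV. norm w * \<bar>frechet_derivative \<phi> (at s) (axis i 1)\<bar>)"
      by (intro sum_mono) (auto simp: abs_mult intro!: mult_right_mono component_le_norm_cart)
    also have "\<dots> = norm (h s) * norm w"
      by (simp add: h_def sum_distrib_left[symmetric] sum_nonneg)
    finally show ?thesis .
  qed
  have meas: "(\<lambda>s. frechet_derivative \<phi> (at s) (u s)) \<in> borel_measurable (lebesgue_on \<Omega>)"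
    if "u \<in> Lp_space \<Omega> p" for u :: "real^'n \<Rightarrow> real^'n"
  proof -
    have [measurable]: "u \<in> borel_measurable (lebesgue_on \<Omega>)" using that by (rule Lp_spaceD)
    have [measurable]: "(\<lambda>s. frechet_derivative \<phi> (at s) (axis i 1)) \<in> borel_measurable (lebesgue_on \<Omega>)" for i
      using test_functionD(4)[OF \<phi>] L
      by (intro continuous_imp_measurable_on_sets_lebesgue) (auto intro: continuous_on_subset)
    show ?thesis by (subst linear_eq_sum_axis[OF lin]) measurable
  qed
  have int: "integrable (lebesgue_on \<Omega>) (\<lambda>s. frechet_derivative \<phi> (at s) (u s))"
    and le: "\<bar>LINT s|lebesgue_on \<Omega>. frechet_derivative \<phi> (at s) (u s)\<bar> \<le> Lp_norm \<Omega> q h * Lp_norm \<Omega> p u"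
    if u: "u \<in> Lp_space \<Omega> p" for u :: "real^'n \<Rightarrow> real^'n"
  proof -
    note H = Holder_Lp[OF q(1) p q(2) h u]
    show I: "integrable (lebesgue_on \<Omega>) (\<lambda>s. frechet_derivative \<phi> (at s) (u s))"
      by (rule Bochner_Integration.integrable_bound[OF H(1) meas[OF u]]) (use bound in auto)
    have "\<bar>LINT s|lebesgue_on \<Omega>. frechet_derivative \<phi> (at s) (u s)\<bar>
        \<le> (LINT s|lebesgue_on \<Omega>. \<bar>frechet_derivative \<phi> (at s) (u s)\<bar>)"
      by (rule integral_abs_bound)
    also have "\<dots> \<le> (LINT s|lebesgue_on \<Omega>. norm (h s) * norm (u s))"
      using bound I H(1) by (intro integral_mono) auto
    also note H(2)
    finally show "\<bar>LINT s|lebesgue_on \<Omega>. frechet_derivative \<phi> (at s) (u s)\<bar> \<le> Lp_norm \<Omega> q h * Lp_norm \<Omega> p u" .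
  qed
  obtain \<xi> where \<xi>: "\<And>n. \<xi> n \<in> solenoidal_tests \<Omega>" "(\<lambda>n. W1p_norm \<Omega> p (x - \<xi> n)) \<longlonglongrightarrow> 0"
    using Vp_space_approximation[OF x] by metis
  have p0: "p > 0" "p \<ge> 0" using p by auto
  have xL: "x \<in> Lp_space \<Omega> p"
    by (rule W1p_spaceD[OF \<Omega> Vp_spaceD(2)[OF x]])
  have \<xi>L: "\<xi> n \<in> Lp_space \<Omega> p" for n
    using \<xi>(1)[of n] by (intro W1p_spaceD[OF \<Omega> test_function_in_W1p(1)[OF \<Omega> p0(1)]])
      (auto simp: solenoidal_tests_def)
  let ?I = "LINT s|lebesgue_on \<Omega>. frechet_derivative \<phi> (at s) (x s)"
  have "\<bar>?I\<bar> \<le> Lp_norm \<Omega> q h * W1p_norm \<Omega> p (x - \<xi> n)" for n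
  proof -
    have d: "x - \<xi> n \<in> Lp_space \<Omega> p"
      using Lp_space_diff(1)[OF xL \<xi>L[of n] p0(2)] by (simp add: fun_diff_def)
    \<comment> \<open>Subtracting a solenoidal test function does not change the integral, so the
      whole integral is bounded by the approximation error.\<close>
    have "(LINT s|lebesgue_on \<Omega>. frechet_derivative \<phi> (at s) ((x - \<xi> n) s))
        = ?I - (LINT s|lebesgue_on \<Omega>. frechet_derivative \<phi> (at s) (\<xi> n s))"
      using int[OF xL] int[OF \<xi>L[of n]] by (simp add: linear_diff[OF lin])
    also have "\<dots> = ?I" using solenoidal_weakly_divergence_free[OF \<Omega> \<xi>(1) \<phi>] by simp
    finally have "\<bar>?I\<bar> \<le> Lp_norm \<Omega> q h * Lp_norm \<Omega> p (x - \<xi> n)" using le[OF d] by simp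
    also have "\<dots> \<le> Lp_norm \<Omega> q h * W1p_norm \<Omega> p (x - \<xi> n)"
      by (intro mult_left_mono norms_le_W1p_norm p0 Lp_norm_nonneg)
    finally show ?thesis .
  qed
  moreover have "(\<lambda>n. Lp_norm \<Omega> q h * W1p_norm \<Omega> p (x - \<xi> n)) \<longlonglongrightarrow> Lp_norm \<Omega> q h * 0"
    by (intro tendsto_mult \<xi>(2) tendsto_const)
  ultimately have "\<bar>?I\<bar> \<le> Lp_norm \<Omega> q h * 0"
    by (intro tendsto_lowerbound[of _ _ sequentially]) auto
  then show ?thesis by simp
qed

text \<open>The integrand is half the derivative of $|\zeta|^2$ in direction $x$.\<close>

lemma convection_test_function_eq_0:
  fixes x :: "real^'n \<Rightarrow> real^'n"
  assumes \<Omega>: "open \<Omega>" and p: "p > 1" and x: "x \<in> Vp_space \<Omega> p" and \<zeta>: "\<zeta> \<in> test_functions \<Omega>"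
  shows "(LINT s|lebesgue_on \<Omega>. (jacobian \<zeta> (at s) *v x s) \<bullet> \<zeta> s) = 0"
proof -
  define \<phi> where "\<phi> s = (\<Sum>i\<in>UNIV. \<zeta> s $ i * \<zeta> s $ i)" for s
  have "{s. \<phi> s \<noteq> 0} \<subseteq> {s. \<zeta> s \<noteq> 0}" by (auto simp: \<phi>_def)
  then have sub: "closure {s. \<phi> s \<noteq> 0} \<subseteq> closure {s. \<zeta> s \<noteq> 0}" by (rule closure_mono)
  have "compact (closure {s. \<phi> s \<noteq> 0})"
    using sub \<zeta> closed_closure compact_Int_closed[of "closure {s. \<zeta> s \<noteq> 0}" "closure {s. \<phi> s \<noteq> 0}"]
    by (auto simp: test_functions_def Int_absorb1)
  moreover have "Ck_on k UNIV \<phi>" for k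
    unfolding \<phi>_def
    by (intro Ck_sum Ck_mult Ck_on_bounded_linear[OF bounded_linear_vec_nth] test_functionD[OF \<zeta>])
  ultimately have \<phi>: "\<phi> \<in> test_functions \<Omega>"
    using sub \<zeta> by (auto simp: test_functions_def)
  have D: "frechet_derivative \<phi> (at s) v = 2 * ((jacobian \<zeta> (at s) *v v) \<bullet> \<zeta> s)" for s v
  proof -
    have d: "(\<zeta> has_derivative frechet_derivative \<zeta> (at s)) (at s)"
      using test_functionD(3)[OF \<zeta>] by (simp flip: frechet_derivative_works)
    have "(\<phi> has_derivative (\<lambda>v. 2 * (frechet_derivative \<zeta> (at s) v \<bullet> \<zeta> s))) (at s)"
      unfolding \<phi>_def inner_vec_def
      by (rule derivative_eq_intros bounded_linear.has_derivative[OF bounded_linear_vec_nth d] refl)+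
         (simp add: fun_eq_iff sum_distrib_left algebra_simps sum.distrib[symmetric])
    then have "frechet_derivative \<phi> (at s) = (\<lambda>v. 2 * (frechet_derivative \<zeta> (at s) v \<bullet> \<zeta> s))"
      by (rule frechet_derivative_at[symmetric])
    moreover have "jacobian \<zeta> (at s) *v v = frechet_derivative \<zeta> (at s) v"
      unfolding jacobian_def
      using linear_frechet_derivative[OF test_functionD(3)[OF \<zeta>]] by (simp add: matrix_vector_mul)
    ultimately show ?thesis by simp
  qed
  show ?thesis using Vp_weakly_divergence_free[OF \<Omega> p x \<phi>] unfolding D by simp
qed

lemma Vp_norm_nonneg: "Vp_norm \<Omega> p u \<ge> 0"
  by (simp add: Vp_norm_def Lp_norm_nonneg)

text \<open>The two exponents in the Gagliardo-Nirenberg inequality add up to 2. Once the Poincare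
  inequality at exponent 2 replaces the H norm by \<open>k\<close> times the V norm, the right-hand
  side is a multiple of the squared V norm, and a square root makes it linear.\<close>

lemma Lp_norm_le_W1p_norm:
  fixes \<Omega> :: "(real^'n) set"
  assumes P: "poincare_domain \<Omega>" and p: "p \<ge> 2"
    and E: "continuous_embedding (Vp_space \<Omega> p) (Vp_norm \<Omega> p) (V_space \<Omega>) (V_norm \<Omega>)"
    and GN: "gagliardo_nirenberg_const \<Omega> p C" and d: "real CARD('n) < 2 * p"
  obtains M where "M \<ge> 0" "\<And>w. w \<in> Vp_space \<Omega> p \<Longrightarrow> Lp_norm \<Omega> (2 * p / (p - 1)) w \<le> M * W1p_norm \<Omega> p w"
proof -
  obtain l where l: "l > 0" "\<And>\<psi>. \<psi> \<in> W01p_space \<Omega> 2 \<Longrightarrow>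
      l * (LINT s|lebesgue_on \<Omega>. norm (\<psi> s) powr 2) \<le> (LINT s|lebesgue_on \<Omega>. norm (weak_gradient \<Omega> \<psi> s) powr 2)"
    using P unfolding poincare_domain_def by (metis one_le_numeral)
  obtain c where c: "c > 0" "\<And>w. w \<in> Vp_space \<Omega> p \<Longrightarrow> V_norm \<Omega> w \<le> c * Vp_norm \<Omega> p w"
    and sub: "Vp_space \<Omega> p \<subseteq> V_space \<Omega>"
    using E unfolding continuous_embedding_def by auto
  define k where "k = (1 / l) powr (1 / 2)"
  \<comment> \<open>The exponent of the H norm; being positive, it allows the Poincare bound to be
    inserted under the power.\<close>
  define e where "e = (2 * p - real CARD('n)) / p"
  have e: "e > 0" "real CARD('n) / p + e = 2" using p d by (auto simp: e_def field_simps)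
  define M where "M = sqrt (C * k powr e) * c"
  have C: "C > 0" using GN by (simp add: gagliardo_nirenberg_const_def)
  show thesis
  proof (rule that)
    show "M \<ge> 0" using C c(1) by (simp add: M_def)
    fix w assume w: "w \<in> Vp_space \<Omega> p"
    let ?V = "V_norm \<Omega> w"
    have V: "?V \<ge> 0" by (rule Vp_norm_nonneg)
    have wV: "w \<in> V_space \<Omega>" using w sub by auto
    have "(LINT s|lebesgue_on \<Omega>. norm (w s) powr 2)
        \<le> (1 / l) * (LINT s|lebesgue_on \<Omega>. norm (weak_gradient \<Omega> w s) powr 2)"
      using l(2)[OF Vp_spaceD(1)[OF wV]] l(1) by (simp add: field_simps)
    then have "(LINT s|lebesgue_on \<Omega>. norm (w s) powr 2) powr (1 / 2)
        \<le> ((1 / l) * (LINT s|lebesgue_on \<Omega>. norm (weak_gradient \<Omega> w s) powr 2)) powr (1 / 2)"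
      by (intro powr_mono2) auto
    then have H: "H_norm \<Omega> w \<le> k * ?V"
      unfolding Lp_norm_def Vp_norm_def k_def using l(1)
      by (subst powr_mult[symmetric]) auto
    have "(Lp_norm \<Omega> (2 * p / (p - 1)) w)\<^sup>2 \<le> C * ?V powr (real CARD('n) / p) * H_norm \<Omega> w powr e"
      using GN wV by (auto simp: gagliardo_nirenberg_const_def e_def)
    also have "\<dots> \<le> C * ?V powr (real CARD('n) / p) * (k * ?V) powr e"
      using H C e by (intro mult_left_mono powr_mono2) (auto simp: Lp_norm_nonneg)
    also have "(k * ?V) powr e = k powr e * ?V powr e"
      using V by (simp add: powr_mult k_def)
    also have "C * ?V powr (real CARD('n) / p) * (k powr e * ?V powr e)
        = C * k powr e * (?V powr (real CARD('n) / p) * ?V powr e)"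
      by simp
    also have "?V powr (real CARD('n) / p) * ?V powr e = ?V\<^sup>2"
      using V by (cases "?V = 0") (simp_all add: powr_add[symmetric] e(2))
    finally have "Lp_norm \<Omega> (2 * p / (p - 1)) w \<le> sqrt (C * k powr e * ?V\<^sup>2)"
      by (rule real_le_rsqrt)
    also have "\<dots> = sqrt (C * k powr e) * ?V" using V by (simp add: real_sqrt_mult)
    also have "\<dots> \<le> sqrt (C * k powr e) * (c * W1p_norm \<Omega> p w)"
    proof (rule mult_left_mono)
      have "c * Vp_norm \<Omega> p w \<le> c * W1p_norm \<Omega> p w"
        using c(1) p by (intro mult_left_mono norms_le_W1p_norm) auto
      then show "?V \<le> c * W1p_norm \<Omega> p w" using c(2)[OF w] by linarith
    qed (use C in simp)
    finally show "Lp_norm \<Omega> (2 * p / (p - 1)) w \<le> M * W1p_norm \<Omega> p w"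
      by (simp add: M_def mult.assoc)
  qed
qed

lemma Vp_space_Lp:
  fixes \<Omega> :: "(real^'n) set"
  assumes "continuous_embedding (Vp_space \<Omega> p) (Vp_norm \<Omega> p) (V_space \<Omega>) (V_norm \<Omega>)"
    and "gagliardo_nirenberg_const \<Omega> p C" and "w \<in> Vp_space \<Omega> p"
  shows "w \<in> Lp_space \<Omega> (2 * p / (p - 1))"
  using assms unfolding continuous_embedding_def gagliardo_nirenberg_const_def by blast

text \<open>For fixed \<open>x\<close> the form \<open>?b\<close> is bilinear and vanishes at
  (\<zeta>, \<zeta>) for test functions. Writing \<zeta> = z - w and expanding expresses
  \<open>?b z z\<close> through terms that each contain the error w, whose gradient norm and
  2p/(p-1)-norm both tend to 0.\<close>

lemma convection_eq_0:
  fixes \<Omega> :: "(real^'n) set" and x z :: "real^'n \<Rightarrow> real^'n"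
  assumes \<Omega>: "open \<Omega>" and P: "poincare_domain \<Omega>" and p: "p \<ge> 2"
    and E: "continuous_embedding (Vp_space \<Omega> p) (Vp_norm \<Omega> p) (V_space \<Omega>) (V_norm \<Omega>)"
    and GN: "gagliardo_nirenberg_const \<Omega> p C" and d: "real CARD('n) < 2 * p"
    and x: "x \<in> Vp_space \<Omega> p" and z: "z \<in> Vp_space \<Omega> p"
  shows "(LINT s|lebesgue_on \<Omega>. (weak_gradient \<Omega> z s *v x s) \<bullet> z s) = 0"
proof -
  have p': "p > 1" "p > 0" "p \<ge> 0" "p \<ge> 1" using p by auto
  let ?q = "2 * p / (p - 1)"
  note Lq = Vp_space_Lp[OF E GN]
  obtain M where M: "M \<ge> 0" "\<And>w. w \<in> Vp_space \<Omega> p \<Longrightarrow> Lp_norm \<Omega> ?q w \<le> M * W1p_norm \<Omega> p w"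
    using Lp_norm_le_W1p_norm[OF P p E GN d] by metis
  obtain \<zeta> where \<zeta>: "\<And>n. \<zeta> n \<in> solenoidal_tests \<Omega>" "(\<lambda>n. W1p_norm \<Omega> p (z - \<zeta> n)) \<longlonglongrightarrow> 0"
    using Vp_space_approximation[OF z] by metis
  have \<zeta>V: "\<zeta> n \<in> Vp_space \<Omega> p" for n using \<zeta>(1) solenoidal_tests_subset_Vp[OF \<Omega> p'(2)] by auto
  have \<zeta>T: "\<zeta> n \<in> test_functions \<Omega>" for n using \<zeta>(1) by (auto simp: solenoidal_tests_def)
  define w where "w n = z - \<zeta> n" for n
  have w: "w n \<in> Vp_space \<Omega> p" for n unfolding w_def by (rule Vp_space_diff[OF \<Omega> p'(4) z \<zeta>V])
  have G: "weak_gradient \<Omega> u \<in> Lp_space \<Omega> p" if "u \<in> Vp_space \<Omega> p" for u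
    by (rule W1p_spaceD(3)[OF \<Omega> Vp_spaceD(2)[OF that]])
  let ?b = "\<lambda>u v. LINT s|lebesgue_on \<Omega>. (weak_gradient \<Omega> u s *v x s) \<bullet> v s"
  have int: "integrable (lebesgue_on \<Omega>) (\<lambda>s. (weak_gradient \<Omega> u s *v x s) \<bullet> v s)"
    and le: "\<bar>?b u v\<bar> \<le> Lp_norm \<Omega> ?q x * (Vp_norm \<Omega> p u * Lp_norm \<Omega> ?q v)"
    if "u \<in> Vp_space \<Omega> p" "v \<in> Vp_space \<Omega> p" for u v
    using trilinear_Lp[OF p'(1) G[OF that(1)] Lq[OF x] Lq[OF that(2)]]
    by (auto simp: Vp_norm_def mult_ac)
  have AE: "AE s in lebesgue_on \<Omega>. weak_gradient \<Omega> z s = weak_gradient \<Omega> (w n) s + jacobian (\<zeta> n) (at s)" for n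
    using W1p_space_diff(2)[OF \<Omega> p'(3) Vp_spaceD(2)[OF z] Vp_spaceD(2)[OF \<zeta>V[of n]]]
      test_function_in_W1p(2)[OF \<Omega> p'(2) \<zeta>T[of n]]
    unfolding w_def by eventually_elim simp
  have eq: "?b z z = ?b (w n) z + ?b z (w n) - ?b (w n) (w n)" for n
  proof -
    note I = int[OF z z] int[OF w[of n] z] int[OF z w[of n]] int[OF w[of n] w[of n]]
    have J: "(LINT s|lebesgue_on \<Omega>. (jacobian (\<zeta> n) (at s) *v x s) \<bullet> \<zeta> n s) = 0"
      by (rule convection_test_function_eq_0[OF \<Omega> p'(1) x \<zeta>T])
    let ?r = "\<lambda>s. (weak_gradient \<Omega> z s *v x s) \<bullet> z s - (weak_gradient \<Omega> (w n) s *v x s) \<bullet> z s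
        - (weak_gradient \<Omega> z s *v x s) \<bullet> w n s + (weak_gradient \<Omega> (w n) s *v x s) \<bullet> w n s"
    have ae: "AE s in lebesgue_on \<Omega>. ?r s = (jacobian (\<zeta> n) (at s) *v x s) \<bullet> \<zeta> n s"
      using AE[of n]
    proof eventually_elim
      case (elim s)
      have "z s = w n s + \<zeta> n s" by (simp add: w_def)
      with elim show ?case
        by (simp add: matrix_vector_mult_add_rdistrib inner_add_left inner_add_right)
    qed
    have r: "integrable (lebesgue_on \<Omega>) ?r"
      by (intro Bochner_Integration.integrable_add Bochner_Integration.integrable_diff I)
    \<comment> \<open>Measurability of the integrand is inherited from \<open>?r\<close>, with which
      it agrees almost everywhere.\<close>
    have "(\<lambda>s. (jacobian (\<zeta> n) (at s) *v x s) \<bullet> \<zeta> n s) \<in> borel_measurable (lebesgue_on \<Omega>)"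
      using \<Omega> by (intro borel_measurable_lebesgue_on_AE[OF _ borel_measurable_integrable[OF r] ae]) auto
    then have "(LINT s|lebesgue_on \<Omega>. ?r s) = 0"
      unfolding J[symmetric] using r ae by (intro integral_cong_AE) auto
    moreover have "(LINT s|lebesgue_on \<Omega>. ?r s) = ?b z z - ?b (w n) z - ?b z (w n) + ?b (w n) (w n)"
      using I by simp
    ultimately show ?thesis by linarith
  qed
  have V0: "(\<lambda>n. Vp_norm \<Omega> p (w n)) \<longlonglongrightarrow> 0"
    by (rule tendsto_sandwich[OF _ _ tendsto_const \<zeta>(2)])
       (auto intro!: always_eventually norms_le_W1p_norm p' simp: Vp_norm_nonneg w_def)
  have "(\<lambda>n. M * W1p_norm \<Omega> p (w n)) \<longlonglongrightarrow> 0"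
    unfolding w_def by (intro tendsto_mult_right_zero \<zeta>(2))
  then have L0: "(\<lambda>n. Lp_norm \<Omega> ?q (w n)) \<longlonglongrightarrow> 0"
    by (rule tendsto_sandwich[OF _ _ tendsto_const, rotated 2]) (simp_all add: M(2) w Lp_norm_nonneg)
  let ?X = "Lp_norm \<Omega> ?q x" and ?Z = "Lp_norm \<Omega> ?q z" and ?G = "Vp_norm \<Omega> p z"
  have "\<bar>?b z z\<bar> \<le> ?X * (Vp_norm \<Omega> p (w n) * ?Z) + ?X * (?G * Lp_norm \<Omega> ?q (w n))
      + ?X * (Vp_norm \<Omega> p (w n) * Lp_norm \<Omega> ?q (w n))" for n
    using le[OF w[of n] z] le[OF z w[of n]] le[OF w[of n] w[of n]] eq[of n] by linarith
  moreover have "(\<lambda>n. ?X * (Vp_norm \<Omega> p (w n) * ?Z) + ?X * (?G * Lp_norm \<Omega> ?q (w n))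
      + ?X * (Vp_norm \<Omega> p (w n) * Lp_norm \<Omega> ?q (w n))) \<longlonglongrightarrow> ?X * (0 * ?Z) + ?X * (?G * 0) + ?X * (0 * 0)"
    by (intro tendsto_intros V0 L0)
  ultimately have "\<bar>?b z z\<bar> \<le> ?X * (0 * ?Z) + ?X * (?G * 0) + ?X * (0 * 0)"
    by (intro tendsto_lowerbound[of _ _ sequentially]) auto
  then show ?thesis by simp
qed

subsection \<open>Monotonicity\<close>

text \<open>The inner product is the left-hand side plus (\<alpha> - \<beta>)/2 times the difference
  of the squared norms. That remainder is nonnegative because the weights are ordered like the
  norms.\<close>

lemma weighted_diff_inner_ge:
  fixes a b :: "'a::real_inner"
  assumes "norm a \<le> norm b \<Longrightarrow> \<alpha> \<le> \<beta>" "norm b \<le> norm a \<Longrightarrow> \<beta> \<le> \<alpha>"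
  shows "(\<alpha> + \<beta>) / 2 * (norm (a - b))\<^sup>2 \<le> (\<alpha> *\<^sub>R a - \<beta> *\<^sub>R b) \<bullet> (a - b)"
proof -
  have "(\<alpha> *\<^sub>R a - \<beta> *\<^sub>R b) \<bullet> (a - b)
      = (\<alpha> + \<beta>) / 2 * (norm (a - b))\<^sup>2 + (\<alpha> - \<beta>) / 2 * ((norm a)\<^sup>2 - (norm b)\<^sup>2)"
    by (simp add: power2_norm_eq_inner inner_diff_left inner_diff_right inner_commute field_simps)
  moreover have "(\<alpha> - \<beta>) * ((norm a)\<^sup>2 - (norm b)\<^sup>2) \<ge> 0"
    using assms by (cases "norm a \<le> norm b")
      (auto intro!: mult_nonneg_nonneg mult_nonpos_nonpos power_mono)
  ultimately show ?thesis by simp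
qed

text \<open>Replacing both norms by their maximum m turns the product into m^r, one of the two
  summands on the right, without conjugate exponents.\<close>

lemma powr_mult_inner_le:
  fixes u v :: "'a::real_inner"
  assumes r: "r \<ge> 2"
  shows "\<bar>norm u powr (r - 2) * (u \<bullet> v)\<bar> \<le> norm u powr r + norm v powr r"
proof -
  define m where "m = max (norm u) (norm v)"
  have m: "norm u \<le> m" "norm v \<le> m" "m \<ge> 0" by (auto simp: m_def intro: le_max_iff_disj[THEN iffD2])
  have "\<bar>norm u powr (r - 2) * (u \<bullet> v)\<bar> \<le> norm u powr (r - 2) * (norm u * norm v)"
    using Cauchy_Schwarz_ineq2[of u v] by (simp add: abs_mult mult_left_mono)
  also have "\<dots> \<le> m powr (r - 2) * (m * m)"
    using m r by (intro mult_mono powr_mono2) auto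
  also have "\<dots> = m powr r"
    using m(3) by (cases "m = 0") (simp_all add: powr_diff power2_eq_square)
  also have "\<dots> \<le> norm u powr r + norm v powr r" by (auto simp: m_def max_def)
  finally show ?thesis .
qed

lemma integrable_powr_inner:
  fixes u v :: "'a::euclidean_space \<Rightarrow> 'b::euclidean_space"
  assumes r: "r \<ge> 2" and u: "u \<in> Lp_space \<Omega> r" and v: "v \<in> Lp_space \<Omega> r"
  shows "integrable (lebesgue_on \<Omega>) (\<lambda>s. norm (u s) powr (r - 2) * (u s \<bullet> v s))"
proof (rule Bochner_Integration.integrable_bound)
  show "integrable (lebesgue_on \<Omega>) (\<lambda>s. norm (u s) powr r + norm (v s) powr r)"
    using Lp_spaceD[OF u] Lp_spaceD[OF v] by auto
  show "AE s in lebesgue_on \<Omega>. norm (norm (u s) powr (r - 2) * (u s \<bullet> v s)) \<le> norm (norm (u s) powr r + norm (v s) powr r)"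
    using powr_mult_inner_le[OF r] by auto
  have [measurable]: "u \<in> borel_measurable (lebesgue_on \<Omega>)" "v \<in> borel_measurable (lebesgue_on \<Omega>)"
    using Lp_spaceD[OF u] Lp_spaceD[OF v] by auto
  show "(\<lambda>s. norm (u s) powr (r - 2) * (u s \<bullet> v s)) \<in> borel_measurable (lebesgue_on \<Omega>)"
    by measurable
qed

text \<open>The weight is at most a constant times 1 + |u|^(p-2). The first part pairs square
  integrable functions, the second p-integrable ones; on a domain of infinite measure neither
  condition implies the other, so both are assumed.\<close>

lemma integrable_one_plus_powr_inner:
  fixes u v :: "'a::euclidean_space \<Rightarrow> 'b::euclidean_space"
  assumes p: "p \<ge> 2" and u: "u \<in> Lp_space \<Omega> p" "u \<in> Lp_space \<Omega> 2"
    and v: "v \<in> Lp_space \<Omega> p" "v \<in> Lp_space \<Omega> 2"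
  shows "integrable (lebesgue_on \<Omega>) (\<lambda>s. (1 + (norm (u s))\<^sup>2) powr ((p - 2) / 2) * (u s \<bullet> v s))"
proof (rule Bochner_Integration.integrable_bound)
  have [measurable]: "u \<in> borel_measurable (lebesgue_on \<Omega>)" "v \<in> borel_measurable (lebesgue_on \<Omega>)"
    using u v by (auto dest: Lp_spaceD)
  \<comment> \<open>The exponent \<open>2 - 2\<close> encodes the weight 1 in the shape of
    \<open>integrable_powr_inner\<close>. It is 0 rather than 1 where \<open>u s = 0\<close>, but
    the inner product vanishes there too.\<close>
  show "integrable (lebesgue_on \<Omega>) (\<lambda>s. 2 powr ((p - 2) / 2) * (norm (norm (u s) powr (2 - 2) * (u s \<bullet> v s))
      + norm (norm (u s) powr (p - 2) * (u s \<bullet> v s))))"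
    using u v p by (intro integrable_mult_right Bochner_Integration.integrable_add integrable_norm integrable_powr_inner) auto
  show "(\<lambda>s. (1 + (norm (u s))\<^sup>2) powr ((p - 2) / 2) * (u s \<bullet> v s)) \<in> borel_measurable (lebesgue_on \<Omega>)"
    by measurable
  have "\<bar>(1 + (norm a)\<^sup>2) powr ((p - 2) / 2) * (a \<bullet> b)\<bar>
      \<le> 2 powr ((p - 2) / 2) * (\<bar>norm a powr (2 - 2) * (a \<bullet> b)\<bar> + \<bar>norm a powr (p - 2) * (a \<bullet> b)\<bar>)" for a b :: 'b
  proof (cases "a = 0")
    case False
    have "(1 + (norm a)\<^sup>2) powr ((p - 2) / 2) \<le> 2 powr ((p - 2) / 2) * (1 powr ((p - 2) / 2) + (norm a)\<^sup>2 powr ((p - 2) / 2))"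
      using p by (intro powr_add_le) auto
    also have "(norm a)\<^sup>2 powr ((p - 2) / 2) = norm a powr (p - 2)"
    proof -
      have "2 * ((p - 2) / 2) = p - 2" by simp
      then have "(norm a powr 2) powr ((p - 2) / 2) = norm a powr (p - 2)" by (simp only: powr_powr)
      then show ?thesis using False by simp
    qed
    finally have "(1 + (norm a)\<^sup>2) powr ((p - 2) / 2) * \<bar>a \<bullet> b\<bar>
        \<le> (2 powr ((p - 2) / 2) * (1 + norm a powr (p - 2))) * \<bar>a \<bullet> b\<bar>"
      by (intro mult_right_mono) auto
    then show ?thesis using False by (simp add: abs_mult algebra_simps)
  qed simp
  then show "AE s in lebesgue_on \<Omega>. norm ((1 + (norm (u s))\<^sup>2) powr ((p - 2) / 2) * (u s \<bullet> v s))
      \<le> norm (2 powr ((p - 2) / 2) * (norm (norm (u s) powr (2 - 2) * (u s \<bullet> v s))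
        + norm (norm (u s) powr (p - 2) * (u s \<bullet> v s))))"
    by (auto simp: abs_mult)
qed

lemma A_op_strongly_monotone:
  assumes \<Omega>: "open \<Omega>" and p: "p \<ge> 2"
    and x: "x \<in> W1p_space \<Omega> p" "x \<in> W1p_space \<Omega> 2" and y: "y \<in> W1p_space \<Omega> p" "y \<in> W1p_space \<Omega> 2"
  shows "(V_norm \<Omega> (x - y))\<^sup>2 \<le> A_op \<Omega> p x (x - y) - A_op \<Omega> p y (x - y)"
proof -
  let ?w = "\<lambda>G. (1 + (norm G)\<^sup>2) powr ((p - 2) / 2)"
  define X where "X = weak_gradient \<Omega> x"
  define Y where "Y = weak_gradient \<Omega> y"
  define Z where "Z = weak_gradient \<Omega> (x - y)"
  have p0: "p \<ge> 0" using p by simp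
  have z: "x - y \<in> W1p_space \<Omega> p" "x - y \<in> W1p_space \<Omega> 2"
    using W1p_space_diff(1)[OF \<Omega> p0 x(1) y(1)] W1p_space_diff(1)[OF \<Omega> _ x(2) y(2)] by auto
  note L = W1p_spaceD(3)[OF \<Omega> x(1)] W1p_spaceD(3)[OF \<Omega> x(2)] W1p_spaceD(3)[OF \<Omega> y(1)]
    W1p_spaceD(3)[OF \<Omega> y(2)] W1p_spaceD(3)[OF \<Omega> z(1)] W1p_spaceD(3)[OF \<Omega> z(2)]
  note L = L[folded X_def Y_def Z_def]
  have ae: "AE s in lebesgue_on \<Omega>. Z s = X s - Y s"
    unfolding X_def Y_def Z_def by (rule W1p_space_diff(2)[OF \<Omega> p0 x(1) y(1)])
  note IX = integrable_one_plus_powr_inner[OF p L(1,2) L(5,6)]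
    and IY = integrable_one_plus_powr_inner[OF p L(3,4) L(5,6)]
  have V: "(V_norm \<Omega> (x - y))\<^sup>2 = (LINT s|lebesgue_on \<Omega>. norm (Z s) powr 2)"
    unfolding Vp_norm_def Z_def using Lp_norm_powr[of 2 \<Omega> "weak_gradient \<Omega> (x - y)"]
    by (simp add: Lp_norm_nonneg)
  have "(LINT s|lebesgue_on \<Omega>. norm (Z s) powr 2)
      \<le> (LINT s|lebesgue_on \<Omega>. ?w (X s) * (X s \<bullet> Z s) - ?w (Y s) * (Y s \<bullet> Z s))"
  proof (rule integral_mono_AE)
    show "integrable (lebesgue_on \<Omega>) (\<lambda>s. norm (Z s) powr 2)" by (rule Lp_spaceD[OF L(6)])
    show "integrable (lebesgue_on \<Omega>) (\<lambda>s. ?w (X s) * (X s \<bullet> Z s) - ?w (Y s) * (Y s \<bullet> Z s))"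
      using IX IY by auto
    show "AE s in lebesgue_on \<Omega>. norm (Z s) powr 2 \<le> ?w (X s) * (X s \<bullet> Z s) - ?w (Y s) * (Y s \<bullet> Z s)"
      using ae
    proof eventually_elim
      case (elim s)
      have w1: "?w G \<ge> 1" for G :: "real^'a^'a" using p by (intro ge_one_powr_ge_zero) auto
      have "(?w (X s) + ?w (Y s)) / 2 * (norm (X s - Y s))\<^sup>2
          \<le> (?w (X s) *\<^sub>R X s - ?w (Y s) *\<^sub>R Y s) \<bullet> (X s - Y s)"
        using p by (intro weighted_diff_inner_ge powr_mono2 add_left_mono power_mono) auto
      \<comment> \<open>The average of two weights, each at least 1, yields the coefficient 1 of the
        squared V norm.\<close>
      moreover have "1 * (norm (X s - Y s))\<^sup>2 \<le> (?w (X s) + ?w (Y s)) / 2 * (norm (X s - Y s))\<^sup>2"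
        using w1[of "X s"] w1[of "Y s"] by (intro mult_right_mono) auto
      ultimately show ?case
        unfolding elim by (simp add: inner_diff_left)
    qed
  qed
  also have "\<dots> = A_op \<Omega> p x (x - y) - A_op \<Omega> p y (x - y)"
    unfolding A_op_def using IX IY by (simp add: X_def Y_def Z_def)
  finally show ?thesis unfolding V .
qed

text \<open>The weighted inequality applies pointwise. For \<open>r = 2\<close> the weight is 0 at
  the zero vector and 1 elsewhere, hence still nondecreasing in the norm.\<close>

lemma C_op_monotone:
  assumes r: "r \<ge> 2" and x: "x \<in> Lp_space \<Omega> r" and y: "y \<in> Lp_space \<Omega> r"
  shows "0 \<le> C_op \<Omega> r x (x - y) - C_op \<Omega> r y (x - y)"
proof -
  have z: "x - y \<in> Lp_space \<Omega> r"
    using Lp_space_diff(1)[OF x y] r by (simp add: fun_diff_def)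
  have "0 \<le> norm (x s) powr (r - 2) * (x s \<bullet> (x - y) s) - norm (y s) powr (r - 2) * (y s \<bullet> (x - y) s)" for s
  proof -
    have "(norm (x s) powr (r - 2) + norm (y s) powr (r - 2)) / 2 * (norm (x s - y s))\<^sup>2
        \<le> (norm (x s) powr (r - 2) *\<^sub>R x s - norm (y s) powr (r - 2) *\<^sub>R y s) \<bullet> (x s - y s)"
      using r by (intro weighted_diff_inner_ge powr_mono2) auto
    moreover have "0 \<le> (norm (x s) powr (r - 2) + norm (y s) powr (r - 2)) / 2 * (norm (x s - y s))\<^sup>2"
      by simp
    ultimately have "0 \<le> (norm (x s) powr (r - 2) *\<^sub>R x s - norm (y s) powr (r - 2) *\<^sub>R y s) \<bullet> (x s - y s)"
      by linarith
    then show ?thesis by (simp add: inner_diff_left)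
  qed
  then have "0 \<le> (LINT s|lebesgue_on \<Omega>. norm (x s) powr (r - 2) * (x s \<bullet> (x - y) s)
      - norm (y s) powr (r - 2) * (y s \<bullet> (x - y) s))"
    by (intro Bochner_Integration.integral_nonneg)
  also have "\<dots> = C_op \<Omega> r x (x - y) - C_op \<Omega> r y (x - y)"
    unfolding C_op_def
    by (intro Bochner_Integration.integral_diff integrable_powr_inner r x y z)
  finally show ?thesis .
qed

text \<open>The difference is split so that the term advected by \<open>x\<close> carries the
  gradient of \<open>x - y\<close> and cancels. The only other gradient left is that of
  \<open>y\<close>, so a norm bound on \<open>y\<close> alone suffices.\<close>

lemma B_op_diff_abs_le:
  fixes \<Omega> :: "(real^'n) set" and x y :: "real^'n \<Rightarrow> real^'n"
  assumes \<Omega>: "open \<Omega>" and P: "poincare_domain \<Omega>" and p: "p \<ge> 2"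
    and E: "continuous_embedding (Vp_space \<Omega> p) (Vp_norm \<Omega> p) (V_space \<Omega>) (V_norm \<Omega>)"
    and GN: "gagliardo_nirenberg_const \<Omega> p C" and d: "real CARD('n) < 2 * p"
    and x: "x \<in> Vp_space \<Omega> p" and y: "y \<in> Vp_space \<Omega> p"
  shows "\<bar>B_op \<Omega> x (x - y) - B_op \<Omega> y (x - y)\<bar> \<le> Vp_norm \<Omega> p y * (Lp_norm \<Omega> (2 * p / (p - 1)) (x - y))\<^sup>2"
proof -
  have p': "p > 1" "p \<ge> 0" "p \<ge> 1" using p by auto
  note Lq = Vp_space_Lp[OF E GN]
  define z where "z = x - y"
  have z: "z \<in> Vp_space \<Omega> p" unfolding z_def by (rule Vp_space_diff[OF \<Omega> p'(3) x y])
  have G: "weak_gradient \<Omega> u \<in> Lp_space \<Omega> p" if "u \<in> Vp_space \<Omega> p" for u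
    by (rule W1p_spaceD(3)[OF \<Omega> Vp_spaceD(2)[OF that]])
  have int: "integrable (lebesgue_on \<Omega>) (\<lambda>s. (weak_gradient \<Omega> u s *v v s) \<bullet> z s)"
    if "u \<in> Vp_space \<Omega> p" "v \<in> Vp_space \<Omega> p" for u v
    by (rule trilinear_Lp[OF p'(1) G[OF that(1)] Lq[OF that(2)] Lq[OF z]])
  have ae: "AE s in lebesgue_on \<Omega>. weak_gradient \<Omega> z s = weak_gradient \<Omega> x s - weak_gradient \<Omega> y s"
    unfolding z_def by (rule W1p_space_diff(2)[OF \<Omega> p'(2) Vp_spaceD(2)[OF x] Vp_spaceD(2)[OF y]])
  have "B_op \<Omega> x z - B_op \<Omega> y z
      = (LINT s|lebesgue_on \<Omega>. (weak_gradient \<Omega> x s *v x s) \<bullet> z s - (weak_gradient \<Omega> y s *v y s) \<bullet> z s)"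
    unfolding B_op_def using int[OF x x] int[OF y y] by simp
  also have "\<dots> = (LINT s|lebesgue_on \<Omega>. (weak_gradient \<Omega> z s *v x s) \<bullet> z s + (weak_gradient \<Omega> y s *v z s) \<bullet> z s)"
  proof (rule integral_cong_AE)
    show "AE s in lebesgue_on \<Omega>. (weak_gradient \<Omega> x s *v x s) \<bullet> z s - (weak_gradient \<Omega> y s *v y s) \<bullet> z s
        = (weak_gradient \<Omega> z s *v x s) \<bullet> z s + (weak_gradient \<Omega> y s *v z s) \<bullet> z s"
      using ae
    proof eventually_elim
      case (elim s)
      show ?case unfolding elim
        by (simp add: z_def matrix_vector_mult_diff_rdistrib matrix_vector_mult_diff_distrib
            inner_diff_left inner_diff_right)
    qed
  qed (use int x y z in \<open>auto intro!: borel_measurable_integrable\<close>)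
  also have "\<dots> = (LINT s|lebesgue_on \<Omega>. (weak_gradient \<Omega> y s *v z s) \<bullet> z s)"
    using int[OF z x] int[OF y z] convection_eq_0[OF \<Omega> P p E GN d x z] by simp
  finally have "\<bar>B_op \<Omega> x z - B_op \<Omega> y z\<bar> \<le> Lp_norm \<Omega> p (weak_gradient \<Omega> y)
      * (Lp_norm \<Omega> (2 * p / (p - 1)) z * Lp_norm \<Omega> (2 * p / (p - 1)) z)"
    using trilinear_Lp(2)[OF p'(1) G[OF y] Lq[OF z] Lq[OF z]] by simp
  then show ?thesis by (simp add: z_def Vp_norm_def power2_eq_square)
qed

text \<open>Young's inequality with P = 2p/d and Q = 2p/(2p-d), which turn the powers of V and H
  into squares. The weight \<open>\<kappa>\<close> = \<mu> p / d solves \<kappa>/P = \<mu>/2; since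
  Q/P = d/(2p-d), its inverse enters the other term with the power seen in \<open>eta_tilde\<close>,
  and 1/Q is the middle factor there.\<close>

lemma gagliardo_nirenberg_Young:
  fixes d p \<mu> C N V H :: real
  assumes d: "d > 0" and dp: "d < 2 * p" and \<mu>: "\<mu> > 0" and C: "C > 0" and N: "N > 0"
    and V: "V \<ge> 0" and H: "H \<ge> 0"
  shows "N * (C * V powr (d / p) * H powr ((2 * p - d) / p))
    \<le> \<mu> / 2 * V\<^sup>2 + eta_tilde d \<mu> p C * N powr (2 * p / (2 * p - d)) * H\<^sup>2"
proof -
  have p: "p > 0" using d dp by simp
  define P where "P = 2 * p / d"
  define Q where "Q = 2 * p / (2 * p - d)"
  have PQ: "P > 1" "Q > 1" "1 / P + 1 / Q = 1"
    using d dp p by (auto simp: P_def Q_def field_simps)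
  define \<kappa> where "\<kappa> = \<mu> * p / d"
  have \<kappa>: "\<kappa> > 0" using \<mu> p d by (simp add: \<kappa>_def)
  define a where "a = \<kappa> powr (1 / P) * V powr (d / p)"
  define b where "b = N * C * \<kappa> powr (- (1 / P)) * H powr ((2 * p - d) / p)"
  have "N * (C * V powr (d / p) * H powr ((2 * p - d) / p))
      = (N * C * V powr (d / p) * H powr ((2 * p - d) / p)) * (\<kappa> powr (1 / P) * \<kappa> powr (- (1 / P)))"
    using \<kappa> by (simp flip: powr_add)
  also have "\<dots> = a * b" by (simp add: a_def b_def)
  also have "\<dots> \<le> a powr P / P + b powr Q / Q"
    using N C by (intro Youngs_inequality PQ) (auto simp: a_def b_def)
  also have "a powr P = \<kappa> * V\<^sup>2"
  proof -
    have "a powr P = (\<kappa> powr (1 / P)) powr P * (V powr (d / p)) powr P" by (simp add: a_def powr_mult)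
    also have "(\<kappa> powr (1 / P)) powr P = \<kappa>" using \<kappa> PQ by (simp add: powr_powr)
    also have "(V powr (d / p)) powr P = V\<^sup>2"
      using V d p by (simp add: powr_powr P_def)
    finally show ?thesis .
  qed
  also have "\<kappa> * V\<^sup>2 / P = \<mu> / 2 * V\<^sup>2" using d p by (simp add: \<kappa>_def P_def field_simps)
  also have "b powr Q / Q = eta_tilde d \<mu> p C * N powr (2 * p / (2 * p - d)) * H\<^sup>2"
  proof -
    have "b powr Q = N powr Q * C powr Q * (\<kappa> powr (- (1 / P))) powr Q * (H powr ((2 * p - d) / p)) powr Q"
      using N C by (simp add: b_def powr_mult)
    also have "(H powr ((2 * p - d) / p)) powr Q = H\<^sup>2"
    proof -
      have "(2 * p - d) / p * Q = (2 * p - d) / (2 * p - d) * (2 * p / p)"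
        unfolding Q_def times_divide_times_eq by (simp only: mult_ac)
      also have "\<dots> = 2" using dp p by simp
      finally have "(2 * p - d) / p * Q = 2" .
      then show ?thesis using H by (simp only: powr_powr) simp
    qed
    also have "(\<kappa> powr (- (1 / P))) powr Q = \<kappa> powr (- (d / (2 * p - d)))"
      using p dp d by (simp add: powr_powr P_def Q_def)
    also have "\<dots> = (1 / \<kappa>) powr (d / (2 * p - d))"
      using \<kappa> by (simp add: powr_minus_divide powr_divide)
    also have "1 / \<kappa> = d / (\<mu> * p)" by (simp add: \<kappa>_def)
    finally have bQ: "b powr Q = N powr Q * C powr Q * (d / (\<mu> * p)) powr (d / (2 * p - d)) * H\<^sup>2" .
    have "b powr Q / Q = b powr Q * (1 / Q)" by simp
    also have "1 / Q = (2 * p - d) / (2 * p)" by (simp add: Q_def)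
    finally show ?thesis
      unfolding bQ eta_tilde_def Q_def[symmetric] by (simp only: mult_ac)
  qed
  finally show ?thesis .
qed

theorem lemma2p5:
  fixes \<Omega> :: "(real^'n) set"
    and \<mu> \<beta> p r C N :: real
    and x y :: "real^'n \<Rightarrow> real^'n"
  assumes "2 \<le> CARD('n)" and "CARD('n) \<le> 4"
    and "open \<Omega>" and "connected \<Omega>"
    and "uniformly_C2_boundary \<Omega>"
    and "poincare_domain \<Omega>"
    and "\<mu> > 0" and "\<beta> \<ge> 0"
    and "p \<ge> 2" and "p > real CARD('n) / 2" and "r \<ge> 2"
    and "standing_embeddings \<Omega> p r"
    and "gagliardo_nirenberg_const \<Omega> p C"
    and "N > 0"
    and "x \<in> Vp_space \<Omega> p \<inter> Ltilde_space \<Omega> r"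
    and "y \<in> Vp_space \<Omega> p \<inter> Ltilde_space \<Omega> r"
    and "y \<in> Vp_ball \<Omega> p N"
  shows "(H_op \<Omega> \<mu> \<beta> p r x - H_op \<Omega> \<mu> \<beta> p r y) (x - y)
         + eta_tilde (real CARD('n)) \<mu> p C * N powr (2 * p / (2 * p - real CARD('n)))
           * (H_norm \<Omega> (x - y))\<^sup>2 \<ge> 0"
proof -
  let ?d = "real CARD('n)" and ?q = "2 * p / (p - 1)"
  let ?V = "V_norm \<Omega> (x - y)" and ?H = "H_norm \<Omega> (x - y)"
  have d: "?d < 2 * p" using \<open>p > ?d / 2\<close> by simp
  have E: "continuous_embedding (Vp_space \<Omega> p) (Vp_norm \<Omega> p) (V_space \<Omega>) (V_norm \<Omega>)"
    using \<open>standing_embeddings \<Omega> p r\<close> by (simp add: standing_embeddings_def)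
  have Vp: "x \<in> Vp_space \<Omega> p" "y \<in> Vp_space \<Omega> p" "x - y \<in> Vp_space \<Omega> p"
    using assms by (auto intro: Vp_space_diff)
  \<comment> \<open>The embedding into V supplies square integrable gradients, which the weight in
    \<open>A_op\<close> requires in addition to p-integrability.\<close>
  then have V: "x \<in> V_space \<Omega>" "y \<in> V_space \<Omega>" "x - y \<in> V_space \<Omega>"
    using E by (auto simp: continuous_embedding_def)
  have Lr: "x \<in> Lp_space \<Omega> r" "y \<in> Lp_space \<Omega> r"
    using assms by (auto simp: Ltilde_space_def norm_closure_def)
  have A: "?V\<^sup>2 \<le> A_op \<Omega> p x (x - y) - A_op \<Omega> p y (x - y)"
    by (intro A_op_strongly_monotone assms Vp_spaceD Vp V)
  have C: "0 \<le> C_op \<Omega> r x (x - y) - C_op \<Omega> r y (x - y)"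
    by (intro C_op_monotone assms Lr)
  have "\<bar>B_op \<Omega> x (x - y) - B_op \<Omega> y (x - y)\<bar> \<le> Vp_norm \<Omega> p y * (Lp_norm \<Omega> ?q (x - y))\<^sup>2"
    by (intro B_op_diff_abs_le[OF _ _ _ E assms(13) d] assms Vp)
  also have "\<dots> \<le> N * (C * ?V powr (?d / p) * ?H powr ((2 * p - ?d) / p))"
    using assms V(3) by (intro mult_mono) (auto simp: Vp_ball_def gagliardo_nirenberg_const_def)
  also have "\<dots> \<le> \<mu> / 2 * ?V\<^sup>2 + eta_tilde ?d \<mu> p C * N powr (2 * p / (2 * p - ?d)) * ?H\<^sup>2"
    using assms d by (intro gagliardo_nirenberg_Young)
      (auto simp: gagliardo_nirenberg_const_def Vp_norm_nonneg Lp_norm_nonneg)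
  finally have B: "\<bar>B_op \<Omega> x (x - y) - B_op \<Omega> y (x - y)\<bar>
      \<le> \<mu> / 2 * ?V\<^sup>2 + eta_tilde ?d \<mu> p C * N powr (2 * p / (2 * p - ?d)) * ?H\<^sup>2" .
  have "\<mu> * ?V\<^sup>2 \<le> \<mu> * (A_op \<Omega> p x (x - y) - A_op \<Omega> p y (x - y))"
    using A \<open>\<mu> > 0\<close> by (intro mult_left_mono) auto
  \<comment> \<open>The convective term consumes only half of \<open>\<mu> * ?V\<^sup>2\<close>;
    nonnegativity lets the other half be dropped.\<close>
  moreover have "0 \<le> \<mu> * ?V\<^sup>2" using \<open>\<mu> > 0\<close> by simp
  moreover have "0 \<le> \<beta> * (C_op \<Omega> r x (x - y) - C_op \<Omega> r y (x - y))"
    using C \<open>\<beta> \<ge> 0\<close> by simp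
  moreover have "(H_op \<Omega> \<mu> \<beta> p r x - H_op \<Omega> \<mu> \<beta> p r y) (x - y)
      = \<mu> * (A_op \<Omega> p x (x - y) - A_op \<Omega> p y (x - y)) + (B_op \<Omega> x (x - y) - B_op \<Omega> y (x - y))
        + \<beta> * (C_op \<Omega> r x (x - y) - C_op \<Omega> r y (x - y))"
    by (simp add: H_op_def right_diff_distrib)
  ultimately show ?thesis using B by linarith
qed

end
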